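(* Let $f(w)=\mathbb{E}_\zeta[F(w,\zeta)]$ satisfy the spectral upper bound condition with constant $L$ and $\nabla^2f(w)\succeq\mu I$ for all $w\in\mathbb{R}^d$, for some $\mu>0$; let $w^*$ be the unique minimizer of $f$. For any $w_0\in\mathbb{R}^d$ let $\{w_k\}$ be generated by $w_{k+1}=w_k-\alpha_k\widetilde H_k^{-1}g_k$, and suppose that for every $k\ge 0$ the gradient approximation satisfies the stochastic norm condition $$\mathbb{E}\big[\|g_k-\nabla f(w_k)\|_{A_k}^2\,\big|\,w_k,A_k\big]\le\theta_k^2\|\nabla f(w_k)\|_{A_k}^2+\iota_k$$ with $\iota_{k+1}=\iota_ka_g$ for some $\iota_0>0$ and $a_g\in[0,1)$. 1. If $A_k=\widetilde H_k^{-1}$, $\theta_k=\tilde\theta_g\in[0,1)$ and $\alpha_k=\alpha$ with $0<\alpha\le\tilde\mu/L$, then for all $k\ge0$, $\mathbb{E}[f(w_k)-f(w^* )]\le\tilde C_1\tilde\rho_1^{\,k}$, where $$\tilde C_1:=\max\Big\{f(w_0)-f(w^* ),\frac{\tilde L\iota_0}{\mu(1-\tilde\theta_g^2)}\Big\},\qquad\tilde\rho_1:=\max\Big\{1-\frac{\alpha\mu(1-\tilde\theta_g^2)}{2\tilde L},a_g\Big\}.$$ 2. If $g_k$ is an unbiased estimator of $\nabla f(w_k)$, $\theta_k=\tilde\theta_g\ge0$, and either (a) $A_k=\widetilde H_k^{-1}$ and $\alpha_k=\alpha$ with $0<\alpha\le\frac{\tilde\mu}{L(1+\tilde\theta_g^2)}$,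 or (b) $A_k=I$ and $\alpha_k=\alpha$ with $0<\alpha\le\frac{\tilde\mu}{L\left(1+\tilde\theta_g^2\tilde L/\tilde\mu\right)}$, then for all $k\ge0$, $\mathbb{E}[f(w_k)-f(w^* )]\le\tilde C_2\tilde\rho_2^{\,k}$, where $$\tilde C_2:=\max\Big\{f(w_0)-f(w^* ),\frac{L\tilde L\alpha\iota_0}{\mu\tilde\mu\min\{1,\tilde\mu\}}\Big\},\qquad\tilde\rho_2:=\max\Big\{1-\frac{\alpha\mu}{2\tilde L},a_g\Big\}.$$
   Context: Setting: $F(\cdot,\zeta)$ is twice continuously differentiable, $F_i:=F(\cdot,\zeta_i)$ for i.i.d. samples $\zeta_i$ of $\zeta$, and for a finite sample set $S$, $F_S=\frac1{|S|}\sum_{i\in S}F_i$. The random vector $g_k\in\mathbb{R}^d$ is a stochastic approximation of $\nabla f(w_k)$; $g_k$ and the Hessian sample set $S_k$ are drawn independently given the past. "Unbiased" means $\mathbb{E}[g_k\mid w_k,\widetilde H_k]=\nabla f(w_k)$. Conditional expectations given $(w_k,A_k)$ are conditional on the algorithm having reached $w_k$ with matrix $A_k$ (i.e. on the whole history). $\mathbb{E}$ is expectation over all random variables. Hessian approximation: for each $k$ there are weights $\gamma_0,\dots,\gamma_k\in[0,1]$ (possibly depending on $k$) with $\sum_{i=0}^k\gamma_i=1$, and $\widehat H_k=\sum_{i=0}^k\gamma_i\nabla^2F_{S_i}(w_i)$. For symmetric $A=U\Lambda U^T$, $|A|=U|\Lambda|U^T$. For fixed $\tilde\mu>0$, $\widetilde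 H_k=|\widehat H_k|$ if $\lambda_{\min}(|\widehat H_k|)\ge\tilde\mu$, and $\widetilde H_k=|\widehat H_k|+(\tilde\mu-\lambda_{\min}(|\widehat H_k|))I$ otherwise; thus $\widetilde H_k\succeq\tilde\mu I$. Spectral upper bound condition: for every sample size $|S|$ there is $0<L_{|S|}<\infty$ with $\nabla^2F_S(w)\preceq L_{|S|}I$ for all $w\in\mathbb{R}^d$, and $L_{|S|}\le L<\infty$ for all $|S|$; consequently $\nabla^2f(w)\preceq LI$. $\tilde L$ denotes a constant with $\widetilde H_k\preceq\tilde LI$ for all $k$ (with $\tilde L\le L+\tilde\mu$). $\|\cdot\|$ is the Euclidean norm and $\|v\|_A=\sqrt{v^TAv}$. *)

theory Defs
  imports "HOL-Probability.Probability"
begin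

section \<open>Gradients, Hessians and the order on symmetric matrices\<close>

definition grad :: "(real^'n \<Rightarrow> real) \<Rightarrow> real^'n \<Rightarrow> real^'n" where
  "grad f x = (THE v. GDERIV f x :> v)"

definition hess :: "(real^'n \<Rightarrow> real) \<Rightarrow> real^'n \<Rightarrow> real^'n^'n" where
  "hess f x = jacobian (grad f) (at x)"

definition twice_diff :: "(real^'n \<Rightarrow> real) \<Rightarrow> bool" where
  "twice_diff f \<longleftrightarrow> (\<forall>x. f differentiable (at x)) \<and> (\<forall>x. grad f differentiable (at x))"

definition twice_cont_diff :: "(real^'n \<Rightarrow> real) \<Rightarrow> bool" where
  "twice_cont_diff f \<longleftrightarrow> twice_diff f \<and> continuous_on UNIV (hess f)"

text \<open>The Loewner order; it is only used between symmetric matrices.\<close>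

definition loewner_le :: "real^'n^'n \<Rightarrow> real^'n^'n \<Rightarrow> bool" (infix "\<preceq>\<^sub>L" 50) where
  "A \<preceq>\<^sub>L B \<longleftrightarrow> (\<forall>v. 0 \<le> v \<bullet> ((B - A) *v v))"

definition mat_norm :: "real^'n^'n \<Rightarrow> real^'n \<Rightarrow> real" where
  "mat_norm A v = sqrt (v \<bullet> (A *v v))"


section \<open>Spectral absolute value and the eigenvalue shift\<close>

definition diag_mat :: "real^'n \<Rightarrow> real^'n^'n" where
  "diag_mat l = (\<chi> i j. if i = j then l $ i else 0)"

text \<open>The result does not depend on the orthogonal diagonalization, so the
  description below is proper whenever \<open>A\<close> is symmetric.\<close>

definition matrix_abs :: "real^'n^'n \<Rightarrow> real^'n^'n" where
  "matrix_abs A = (THE B. \<exists>U l. orthogonal_matrix U \<and>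
     A = U ** diag_mat l ** transpose U \<and>
     B = U ** diag_mat (\<chi> i. \<bar>l $ i\<bar>) ** transpose U)"

definition eigenvalues :: "real^'n^'n \<Rightarrow> real set" where
  "eigenvalues A = {c. \<exists>v. v \<noteq> 0 \<and> A *v v = c *\<^sub>R v}"

definition lambda_min :: "real^'n^'n \<Rightarrow> real" where
  "lambda_min A = Min (eigenvalues A)"

definition modified_hess :: "real \<Rightarrow> real^'n^'n \<Rightarrow> real^'n^'n" where
  "modified_hess \<mu>t H =
     (if lambda_min (matrix_abs H) \<ge> \<mu>t then matrix_abs H
      else matrix_abs H + (\<mu>t - lambda_min (matrix_abs H)) *\<^sub>R mat 1)"


section \<open>Subsampled functions and averaged Hessians\<close>

text \<open>Sample sets are finite sets of indices into the sequence \<open>\<zeta>\<close> of samples.\<close>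

definition sample_avg ::
  "(real^'n \<Rightarrow> 'z \<Rightarrow> real) \<Rightarrow> (nat \<Rightarrow> 'a \<Rightarrow> 'z) \<Rightarrow> nat set \<Rightarrow> 'a \<Rightarrow> real^'n \<Rightarrow> real" where
  "sample_avg F \<zeta> T \<omega> w = (1 / real (card T)) * (\<Sum>i\<in>T. F w (\<zeta> i \<omega>))"

definition hess_avg ::
  "(real^'n \<Rightarrow> 'z \<Rightarrow> real) \<Rightarrow> (nat \<Rightarrow> 'a \<Rightarrow> 'z) \<Rightarrow> (nat \<Rightarrow> 'a \<Rightarrow> nat set) \<Rightarrow>
   (nat \<Rightarrow> nat \<Rightarrow> real) \<Rightarrow> (nat \<Rightarrow> 'a \<Rightarrow> real^'n) \<Rightarrow> nat \<Rightarrow> 'a \<Rightarrow> real^'n^'n" where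
  "hess_avg F \<zeta> S \<gamma> w k \<omega> =
     (\<Sum>i\<le>k. \<gamma> k i *\<^sub>R hess (sample_avg F \<zeta> (S i \<omega>) \<omega>) (w i \<omega>))"

definition spectral_upper_bound ::
  "'a measure \<Rightarrow> (real^'n \<Rightarrow> 'z \<Rightarrow> real) \<Rightarrow> (nat \<Rightarrow> 'a \<Rightarrow> 'z) \<Rightarrow> real \<Rightarrow> bool" where
  "spectral_upper_bound M F \<zeta> L \<longleftrightarrow>
     (\<exists>Ls :: nat \<Rightarrow> real. \<forall>n\<ge>1. 0 < Ls n \<and> Ls n \<le> L \<and>
        (\<forall>T. finite T \<and> card T = n \<longrightarrow>
           (AE \<omega> in M. \<forall>w. hess (sample_avg F \<zeta> T \<omega>) w \<preceq>\<^sub>L Ls n *\<^sub>R mat 1)))"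


section \<open>History of the algorithm\<close>

definition var_events :: "'a measure \<Rightarrow> ('a \<Rightarrow> 'b::topological_space) \<Rightarrow> 'a set set" where
  "var_events M X = {X -` B \<inter> space M | B. B \<in> sets borel}"

text \<open>Generating events for the sample drawn at iteration \<open>k\<close>: the index set \<open>S k\<close>
  together with the values \<open>\<zeta> i\<close> for \<open>i \<in> S k\<close>, and no other values of \<open>\<zeta>\<close>.\<close>

definition sample_events ::
  "'a measure \<Rightarrow> 'z measure \<Rightarrow> (nat \<Rightarrow> 'a \<Rightarrow> 'z) \<Rightarrow> (nat \<Rightarrow> 'a \<Rightarrow> nat set) \<Rightarrow> nat \<Rightarrow> 'a set set" where
  "sample_events M D \<zeta> S k =
     {{\<omega> \<in> space M. S k \<omega> = T \<and> \<zeta> i \<omega> \<in> B} | T i B. finite T \<and> i \<in> T \<and> B \<in> sets D}"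

text \<open>The past of iteration \<open>k\<close>: everything up to and including \<open>w k\<close>, before
  \<open>g k\<close> and \<open>S k\<close> are drawn.\<close>

definition past ::
  "'a measure \<Rightarrow> 'z measure \<Rightarrow> (nat \<Rightarrow> 'a \<Rightarrow> 'z) \<Rightarrow> (nat \<Rightarrow> 'a \<Rightarrow> nat set) \<Rightarrow>
   (nat \<Rightarrow> 'a \<Rightarrow> real^'n) \<Rightarrow> (nat \<Rightarrow> 'a \<Rightarrow> real^'n) \<Rightarrow> nat \<Rightarrow> 'a measure" where
  "past M D \<zeta> S g w k = sigma (space M)
     ((\<Union>j\<le>k. var_events M (w j)) \<union> (\<Union>j<k. var_events M (g j)) \<union> (\<Union>j<k. sample_events M D \<zeta> S j))"

text \<open>Conditioning on \<open>(w k, X)\<close>, where \<open>X\<close> is a matrix at iteration \<open>k\<close>, means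
  conditioning on the history that led to \<open>w k\<close> together with the value of \<open>X\<close>.\<close>

definition history ::
  "'a measure \<Rightarrow> 'z measure \<Rightarrow> (nat \<Rightarrow> 'a \<Rightarrow> 'z) \<Rightarrow> (nat \<Rightarrow> 'a \<Rightarrow> nat set) \<Rightarrow>
   (nat \<Rightarrow> 'a \<Rightarrow> real^'n) \<Rightarrow> (nat \<Rightarrow> 'a \<Rightarrow> real^'n) \<Rightarrow> nat \<Rightarrow> ('a \<Rightarrow> real^'n^'n) \<Rightarrow> 'a measure" where
  "history M D \<zeta> S g w k X = sigma (space M) (sets (past M D \<zeta> S g w k) \<union> var_events M X)"

definition cond_indep_sets :: "'a measure \<Rightarrow> 'a measure \<Rightarrow> 'a set set \<Rightarrow> 'a set set \<Rightarrow> bool" where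
  "cond_indep_sets M N \<A> \<B> \<longleftrightarrow> (\<forall>A\<in>\<A>. \<forall>B\<in>\<B>. AE \<omega> in M.
     real_cond_exp M N (indicator (A \<inter> B)) \<omega> =
     real_cond_exp M N (indicator A) \<omega> * real_cond_exp M N (indicator B) \<omega>)"

definition cond_unbiased ::
  "'a measure \<Rightarrow> 'a measure \<Rightarrow> ('a \<Rightarrow> real^'n) \<Rightarrow> ('a \<Rightarrow> real^'n) \<Rightarrow> bool" where
  "cond_unbiased M N X Y \<longleftrightarrow> integrable M X \<and>
     (\<forall>i. AE \<omega> in M. real_cond_exp M N (\<lambda>\<omega>. X \<omega> $ i) \<omega> = Y \<omega> $ i)"

end

theory Submission
  imports Defs
begin

text \<open>The quadratic upper bound for \<open>f\<close> applied to one step \<open>w - \<alpha> P g\<close>, with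
  \<open>P\<close> the inverse of the modified Hessian, and \<open>P\<^sup>2 \<preceq> P / \<mu>t\<close> give, for
  \<open>n = \<nabla>f w\<close> and \<open>e = g - n\<close>,
  \<open>f w' \<le> f w - \<alpha> (n P n + n P e) + L \<alpha>\<^sup>2 / (2 \<mu>t) (n P n + 2 n P e + e P e)\<close>.
  In the first part \<open>L \<alpha> \<le> \<mu>t\<close> makes the cross terms cancel; in the second part they have
  expectation zero. The norm condition bounds the expectation of \<open>e P e\<close>, and
  \<open>n P n \<ge> \<bar>n\<bar>\<^sup>2 / Lt \<ge> 2 \<mu> (f w - f wstar) / Lt\<close> by strong convexity. What remains is a
  recursion \<open>a (k + 1) \<le> (1 - 2 r) a k + b ag^k\<close> with \<open>b \<le> r C\<close>, which preserves
  \<open>a k \<le> C max (1 - r) ag ^ k\<close>. The conditional expectations only enter through integrals,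
  so square integrability of \<open>g k\<close> is carried along the same induction.\<close>

section \<open>Spectral decomposition of symmetric matrices\<close>

text \<open>One obstacle is that \<open>modified_hess\<close> rests on a definite description over
  all orthogonal diagonalizations. It becomes usable only when the averaged Hessian is known to be
  symmetric, a diagonalization exists, and the outcome is independent of the one chosen; from there
  on, facts about \<open>P\<close> are facts about reciprocals of numbers in
  \<open>[\<mu>t, Lt]\<close>. The descent contracts by 1 - 2 r, while the claimed rate is 1 - r:
  the half given up pays for the inexactness of the gradients. This is why C is modelled on b / r.
  The minimum of 1 and \<mu>t in the second constant covers both norms at once, since passing from
  the Euclidean norm to that of \<open>P\<close> divides \<iota> by \<mu>t. The weight
  \<open>P\<close> is random as well, so n P e has expectation zero only because unbiasedness is
  conditional on a history that contains the value of \<open>Ht k\<close>. No second moment of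
  \<open>g k\<close> is among the hypotheses: the norm condition is stated with the conditional
  expectation of nonnegative functions, so that integrability of the error comes out as a
  conclusion.\<close>

lemma symmetric_matrix_inner:
  fixes A :: "real^'n^'n"
  assumes "transpose A = A"
  shows "x \<bullet> (A *v y) = (A *v x) \<bullet> y"
  by (metis assms dot_lmul_matrix transpose_matrix_vector)

lemma symmetric_eigenvector_in_subspace:
  fixes A :: "real^'n^'n"
  assumes sym: "transpose A = A" and W: "subspace W"
    and inv: "\<And>x. x \<in> W \<Longrightarrow> A *v x \<in> W" and nz: "\<not> W \<subseteq> {0}"
  obtains v c where "v \<in> W" "norm v = 1" "A *v v = c *\<^sub>R v"
proof -
  \<comment> \<open>A maximizer of the Rayleigh quotient on the unit sphere of \<open>W\<close> is an eigenvector.\<close>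
  let ?K = "W \<inter> sphere 0 1"
  have "compact ?K"
    using W by (simp add: closed_subspace closed_Int_compact)
  moreover have "?K \<noteq> {}"
  proof -
    from nz obtain x where x: "x \<in> W" "x \<noteq> 0" by blast
    then have "(1 / norm x) *\<^sub>R x \<in> ?K"
      using W by (simp add: subspace_scale)
    then show ?thesis by blast
  qed
  moreover have "continuous_on ?K (\<lambda>v. v \<bullet> (A *v v))"
    by (intro continuous_intros linear_continuous_on matrix_vector_mul_bounded_linear)
  ultimately obtain v where v: "v \<in> ?K" and vmax: "\<And>u. u \<in> ?K \<Longrightarrow> u \<bullet> (A *v u) \<le> v \<bullet> (A *v v)"
    using continuous_attains_sup[of ?K "\<lambda>v. v \<bullet> (A *v v)"] by blast
  define c where "c = v \<bullet> (A *v v)"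
  have nv: "norm v = 1" "v \<in> W" using v by auto
  have le: "u \<bullet> (A *v u) \<le> c * (u \<bullet> u)" if "u \<in> W" for u
  proof (cases "u = 0")
    case False
    have "(1 / norm u) *\<^sub>R u \<in> ?K"
      using W that False by (simp add: subspace_scale)
    from vmax[OF this] have "(1 / norm u) * (1 / norm u) * (u \<bullet> (A *v u)) \<le> c"
      by (simp add: c_def matrix_vector_mult_scaleR)
    then have "(u \<bullet> (A *v u)) / (norm u)\<^sup>2 \<le> c" by (simp add: power2_eq_square)
    then show ?thesis
      using False by (simp add: divide_le_eq dot_square_norm)
  qed simp
  \<comment> \<open>The residual lies in \<open>W\<close>, so \<open>v + t *\<^sub>R r\<close> may
    be compared with the maximizer \<open>v\<close>.\<close>
  define r where "r = A *v v - c *\<^sub>R v"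
  have rW: "r \<in> W" using W nv inv by (simp add: r_def subspace_diff subspace_scale)
  define K where "K = c * (r \<bullet> r) - r \<bullet> (A *v r)"
  \<comment> \<open>At \<open>t = 0\<close> both sides of \<open>le\<close> agree. The first-order
    excess is \<open>2 * t * (r \<bullet> r)\<close>, and only a term of order
    \<open>t\<^sup>2\<close> is available to compensate for it.\<close>
  have quad: "2 * t * (r \<bullet> r) \<le> t\<^sup>2 * K" for t
  proof -
    have "v + t *\<^sub>R r \<in> W" using W rW nv by (simp add: subspace_add subspace_scale)
    note q = le[OF this]
    have "v \<bullet> (A *v r) = r \<bullet> (A *v v)"
      using symmetric_matrix_inner[OF sym, of v r] by (simp add: inner_commute)
    then have q1: "(v + t *\<^sub>R r) \<bullet> (A *v (v + t *\<^sub>R r)) = c + 2 * t * (r \<bullet> (A *v v)) + t\<^sup>2 * (r \<bullet> (A *v r))"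
      by (simp add: matrix_vector_right_distrib matrix_vector_mult_scaleR inner_add_left inner_add_right
          c_def power2_eq_square algebra_simps)
    have q2: "(v + t *\<^sub>R r) \<bullet> (v + t *\<^sub>R r) = 1 + 2 * t * (r \<bullet> v) + t\<^sup>2 * (r \<bullet> r)"
      using nv by (simp add: inner_add_left inner_add_right power2_eq_square algebra_simps
          inner_commute norm_eq_1)
    have "2 * t * (r \<bullet> (A *v v)) \<le> 2 * t * (c * (r \<bullet> v)) + t\<^sup>2 * K"
      using q unfolding q1 q2 by (simp add: K_def algebra_simps)
    moreover have "r \<bullet> r = r \<bullet> (A *v v) - c * (r \<bullet> v)"
      by (subst (2) r_def) (simp add: inner_diff_right)
    then have "2 * t * (r \<bullet> r) = 2 * t * (r \<bullet> (A *v v)) - 2 * t * (c * (r \<bullet> v))"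
      by (simp add: right_diff_distrib)
    ultimately show ?thesis by linarith
  qed
  have "r = 0"
  proof (rule ccontr)
    assume "r \<noteq> 0"
    then have rr: "r \<bullet> r > 0" by simp
    \<comment> \<open>For this \<open>t\<close> the product \<open>t * K\<close> is at most
      \<open>r \<bullet> r\<close>, whereas \<open>quad\<close> divided by \<open>t\<close> asks for
      twice that.\<close>
    define t where "t = (r \<bullet> r) / (\<bar>K\<bar> + 1)"
    have t: "t > 0" using rr by (simp add: t_def)
    have "2 * (r \<bullet> r) \<le> t * K" using quad[of t] t by (simp add: power2_eq_square)
    also have "\<dots> \<le> t * (\<bar>K\<bar> + 1)" using t by (intro mult_left_mono) auto
    also have "\<dots> = r \<bullet> r" by (simp add: t_def)
    finally show False using rr by simp
  qed
  then have "A *v v = c *\<^sub>R v" by (simp add: r_def)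
  with nv show ?thesis using that by blast
qed

text \<open>Induction on the dimension: a unit eigenvector \<open>v\<close> is split off, and the
  part of \<open>W\<close> orthogonal to \<open>v\<close> is again invariant because
  \<open>A\<close> is symmetric. The statement speaks of invariant subspaces so that the induction
  can pass to this complement.\<close>

lemma symmetric_orthonormal_eigenbasis:
  fixes A :: "real^'n^'n"
  assumes sym: "transpose A = A" and "subspace W" "\<And>x. x \<in> W \<Longrightarrow> A *v x \<in> W"
  shows "\<exists>B. finite B \<and> B \<subseteq> W \<and> pairwise orthogonal B \<and>
     (\<forall>v\<in>B. norm v = 1 \<and> (\<exists>c. A *v v = c *\<^sub>R v)) \<and> W \<subseteq> span B"
  using assms(2,3)
proof (induction "dim W" arbitrary: W rule: less_induct)
  case less
  show ?case
  proof (cases "W \<subseteq> {0}")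
    case True
    then show ?thesis by (intro exI[of _ "{}"]) (auto simp: pairwise_def)
  next
    case False
    obtain v c where v: "v \<in> W" "norm v = 1" "A *v v = c *\<^sub>R v"
      using symmetric_eigenvector_in_subspace[OF sym less.prems False] by metis
    define W' where "W' = W \<inter> {u. v \<bullet> u = 0}"
    have sW': "subspace W'"
      unfolding W'_def using less.prems(1) by (intro subspace_inter subspace_hyperplane)
    have inv': "A *v x \<in> W'" if "x \<in> W'" for x
      using that less.prems(2) v(3) by (simp add: W'_def symmetric_matrix_inner[OF sym])
    have "v \<notin> W'" using v(2) by (simp add: W'_def norm_eq_1)
    then have "W' \<subset> W" using v(1) unfolding W'_def by blast
    then have "dim W' < dim W"
      using less.prems(1) sW' by (intro dim_psubset) (metis span_eq_iff)
    from less.hyps[OF this sW' inv'] obtain B where B: "finite B" "B \<subseteq> W'" "pairwise orthogonal B"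
      "\<forall>v\<in>B. norm v = 1 \<and> (\<exists>c. A *v v = c *\<^sub>R v)" "W' \<subseteq> span B" by blast
    have "x \<in> span (insert v B)" if "x \<in> W" for x
    proof -
      have "x - (v \<bullet> x) *\<^sub>R v \<in> W'"
        using that v less.prems(1)
        by (simp add: W'_def subspace_diff subspace_scale inner_diff_right norm_eq_1)
      then show ?thesis using B(5) span_breakdown_eq by blast
    qed
    moreover have "pairwise orthogonal (insert v B)"
      using B(2,3) by (auto simp: pairwise_insert W'_def orthogonal_def inner_commute)
    ultimately show ?thesis
      using B v by (intro exI[of _ "insert v B"]) (auto simp: W'_def)
  qed
qed

text \<open>The shape that occurs in \<open>matrix_abs\<close>. For a fixed orthogonal
  \<open>U\<close>, absolute value, shift, product and inverse act on \<open>l\<close> entrywise, so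
  matrix bounds become bounds between real numbers.\<close>

definition spectral_mat :: "real^'n^'n \<Rightarrow> real^'n \<Rightarrow> real^'n^'n" where
  "spectral_mat U l = U ** diag_mat l ** transpose U"

lemma diag_mat_vec: "diag_mat l *v x = (\<chi> i. l $ i * x $ i)"
proof -
  have "(\<Sum>j\<in>UNIV. (if i = j then l $ i else 0) * x $ j)
      = (\<Sum>j\<in>UNIV. if i = j then l $ i * x $ j else 0)" for i
    by (intro sum.cong) auto
  then show ?thesis by (simp add: diag_mat_def matrix_vector_mult_def vec_eq_iff)
qed

lemma diag_mult_matrix: "(diag_mat l ** A) $ i $ j = l $ i * A $ i $ j"
proof -
  have "(\<Sum>k\<in>UNIV. (if i = k then l $ i else 0) * A $ k $ j)
      = (\<Sum>k\<in>UNIV. if i = k then l $ i * A $ k $ j else 0)"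
    by (intro sum.cong) auto
  then show ?thesis by (simp add: diag_mat_def matrix_matrix_mult_def)
qed

lemma matrix_mult_diag: "(A ** diag_mat l) $ i $ j = A $ i $ j * l $ j"
proof -
  have "(\<Sum>k\<in>UNIV. A $ i $ k * (if k = j then l $ k else 0))
      = (\<Sum>k\<in>UNIV. if k = j then A $ i $ k * l $ k else 0)"
    by (intro sum.cong) auto
  then show ?thesis by (simp add: diag_mat_def matrix_matrix_mult_def)
qed

lemma diag_mat_mult: "diag_mat l ** diag_mat m = diag_mat (\<chi> i. l $ i * m $ i)"
  by (simp add: vec_eq_iff diag_mult_matrix) (simp add: diag_mat_def)

lemma orthogonal_matrix_cancel:
  assumes "orthogonal_matrix U"
  shows "transpose U ** U = mat 1" "U ** transpose U = mat 1"
  using assms by (auto simp: orthogonal_matrix_def)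

lemma symmetric_matrix_spectral:
  fixes A :: "real^'n^'n"
  assumes sym: "transpose A = A"
  obtains U l where "orthogonal_matrix U" "A = spectral_mat U l"
proof -
  obtain B where B: "finite B" "pairwise orthogonal B"
    "\<forall>v\<in>B. norm v = 1 \<and> (\<exists>c. A *v v = c *\<^sub>R v)" "UNIV \<subseteq> span B"
    using symmetric_orthonormal_eigenbasis[OF sym, of UNIV] by auto
  have "0 \<notin> B" using B(3) by force
  then have "independent B" using B(2) pairwise_orthogonal_independent by blast
  \<comment> \<open>Independent and spanning, \<open>B\<close> has as many elements as the index
    type; this is what allows its vectors to become the columns of a square matrix.\<close>
  then have "card B = CARD('n)"
    using B(4) dim_eq_card[of B UNIV] by (simp add: top.extremum_unique)
  then obtain b where b: "bij_betw b (UNIV :: 'n set) B"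
    using B(1) finite_same_card_bij[of "UNIV :: 'n set" B] by auto
  have bB: "b j \<in> B" for j using b by (auto simp: bij_betw_def)
  have "\<forall>j. \<exists>c. A *v b j = c *\<^sub>R b j" using B(3) bB by blast
  from choice[OF this] obtain c where c: "\<And>j. A *v b j = c j *\<^sub>R b j" by blast
  define U :: "real^'n^'n" where "U = (\<chi> i j. b j $ i)"
  have col: "column j U = b j" for j by (simp add: column_def U_def vec_eq_iff)
  have "orthogonal (b i) (b j)" if "i \<noteq> j" for i j
  proof -
    have "b i \<noteq> b j" using b that by (auto simp: bij_betw_def dest: injD)
    then show ?thesis using B(2) bB by (auto simp: pairwise_def)
  qed
  then have U: "orthogonal_matrix U"
    using B(3) bB by (simp add: orthogonal_matrix_orthonormal_columns col)
  have "A ** U = U ** diag_mat (\<chi> j. c j)"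
  proof -
    have "(A ** U) $ i $ j = (U ** diag_mat (\<chi> j. c j)) $ i $ j" for i j
    proof -
      have "(A ** U) $ i $ j = (A *v b j) $ i"
        by (simp add: matrix_matrix_mult_def matrix_vector_mult_def U_def)
      then show ?thesis by (simp add: c matrix_mult_diag U_def)
    qed
    then show ?thesis by (simp add: vec_eq_iff)
  qed
  then have "A = spectral_mat U (\<chi> j. c j)"
    unfolding spectral_mat_def
    by (metis U matrix_mul_assoc matrix_mul_rid orthogonal_matrix_def)
  with U show ?thesis using that by blast
qed

section \<open>Algebra of matrices with a common eigenbasis\<close>

lemma spectral_mat_mult:
  assumes "orthogonal_matrix U"
  shows "spectral_mat U l ** spectral_mat U m = spectral_mat U (\<chi> i. l $ i * m $ i)"
proof -
  have "spectral_mat U l ** spectral_mat U m = U ** diag_mat l ** (transpose U ** U) ** diag_mat m ** transpose U"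
    by (simp add: spectral_mat_def matrix_mul_assoc)
  also have "\<dots> = U ** (diag_mat l ** diag_mat m) ** transpose U"
    by (simp add: orthogonal_matrix_cancel[OF assms] matrix_mul_assoc)
  finally show ?thesis by (simp add: spectral_mat_def diag_mat_mult)
qed

lemma spectral_mat_const:
  assumes "orthogonal_matrix U"
  shows "spectral_mat U (\<chi> i. c) = c *\<^sub>R mat 1"
proof -
  have "U ** diag_mat (\<chi> i. c) = c *\<^sub>R U"
    by (simp add: vec_eq_iff matrix_mult_diag)
  moreover have "(c *\<^sub>R U) ** transpose U = c *\<^sub>R (U ** transpose U)"
    by (simp add: matrix_matrix_mult_def vec_eq_iff sum_distrib_left algebra_simps)
  ultimately show ?thesis
    by (simp add: spectral_mat_def orthogonal_matrix_cancel[OF assms])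
qed

lemma spectral_mat_add:
  fixes U :: "real^'n^'n"
  shows "spectral_mat U l + spectral_mat U m = spectral_mat U (l + m)"
proof -
  have "diag_mat (l + m) = diag_mat l + diag_mat m"
    by (simp add: diag_mat_def vec_eq_iff)
  moreover have "(A + B) ** C = A ** C + B ** C" for A B C :: "real^'n^'n"
    by (simp add: matrix_matrix_mult_def vec_eq_iff sum.distrib algebra_simps)
  ultimately show ?thesis by (simp add: spectral_mat_def matrix_add_ldistrib)
qed

lemma transpose_spectral_mat: "transpose (spectral_mat U l) = spectral_mat U l"
proof -
  have "transpose (diag_mat l) = diag_mat l"
    by (simp add: transpose_def diag_mat_def vec_eq_iff)
  then show ?thesis by (simp add: spectral_mat_def matrix_transpose_mul matrix_mul_assoc)
qed

lemma spectral_mat_column: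
  assumes "orthogonal_matrix U"
  shows "spectral_mat U l *v column i U = l $ i *\<^sub>R column i U"
proof -
  have "U *v axis i 1 = column i U" by (simp add: matrix_vector_mul_component matrix_vector_mult_basis)
  moreover have "diag_mat l *v axis i 1 = l $ i *\<^sub>R axis i 1"
    by (simp add: diag_mat_vec vec_eq_iff axis_def)
  moreover have "transpose U *v (U *v axis i 1) = axis i 1"
    by (simp add: matrix_vector_mul_assoc orthogonal_matrix_cancel[OF assms])
  ultimately show ?thesis
    by (metis matrix_vector_mul_assoc matrix_vector_mult_scaleR spectral_mat_def)
qed

lemma spectral_mat_inner:
  "x \<bullet> (spectral_mat U l *v x) = (\<Sum>i\<in>UNIV. l $ i * ((transpose U *v x) $ i)\<^sup>2)"
proof -
  have "x \<bullet> (spectral_mat U l *v x) = (transpose U *v x) \<bullet> (diag_mat l *v (transpose U *v x))"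
    by (simp add: spectral_mat_def dot_lmul_matrix flip: matrix_vector_mul_assoc)
  then show ?thesis by (simp add: diag_mat_vec inner_vec_def power2_eq_square algebra_simps)
qed

lemma spectral_mat_inner_mono:
  assumes "\<And>i. l $ i \<le> m $ i"
  shows "x \<bullet> (spectral_mat U l *v x) \<le> x \<bullet> (spectral_mat U m *v x)"
  unfolding spectral_mat_inner by (intro sum_mono mult_right_mono assms) auto

text \<open>\<open>lambda_min\<close> is a \<open>Min\<close>, which is informative only for a
  finite nonempty set; a range over the index type is one. For the harder inclusion, the coordinates
  \<open>y\<close> of an eigenvector satisfy \<open>l $ i * y $ i = c * y $ i\<close>, and some
  coordinate is nonzero.\<close>

lemma eigenvalues_spectral_mat:
  assumes U: "orthogonal_matrix U"
  shows "eigenvalues (spectral_mat U l) = range (($) l)"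
proof
  show "range (($) l) \<subseteq> eigenvalues (spectral_mat U l)"
  proof
    fix c assume "c \<in> range (($) l)"
    then obtain i where "c = l $ i" by auto
    moreover have "norm (column i U) = 1"
      using U by (simp add: orthogonal_matrix_orthonormal_columns)
    then have "column i U \<noteq> 0" by force
    ultimately show "c \<in> eigenvalues (spectral_mat U l)"
      using spectral_mat_column[OF U] by (auto simp: eigenvalues_def)
  qed
  show "eigenvalues (spectral_mat U l) \<subseteq> range (($) l)"
  proof
    fix c assume "c \<in> eigenvalues (spectral_mat U l)"
    then obtain v where v: "v \<noteq> 0" "spectral_mat U l *v v = c *\<^sub>R v" by (auto simp: eigenvalues_def)
    define y where "y = transpose U *v v"
    have "U *v y = v" by (simp add: y_def matrix_vector_mul_assoc orthogonal_matrix_cancel[OF U] del: transpose_matrix_vector)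
    then have "y \<noteq> 0" using v(1) by auto
    have "diag_mat l *v y = transpose U *v (spectral_mat U l *v v)"
      by (simp add: y_def spectral_mat_def matrix_vector_mul_assoc matrix_mul_assoc
          orthogonal_matrix_cancel[OF U] del: transpose_matrix_vector)
    also have "\<dots> = c *\<^sub>R y" by (simp add: v(2) y_def matrix_vector_mult_scaleR del: transpose_matrix_vector)
    finally have "l $ i * y $ i = c * y $ i" for i
      by (simp add: diag_mat_vec vec_eq_iff)
    moreover obtain i where "y $ i \<noteq> 0" using \<open>y \<noteq> 0\<close> by (auto simp: vec_eq_iff)
    ultimately have "l $ i = c" by force
    then show "c \<in> range (($) l)" by auto
  qed
qed

lemma spectral_mat_map_unique:
  assumes U: "orthogonal_matrix U" and V: "orthogonal_matrix V"
    and eq: "spectral_mat U l = spectral_mat V m"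
  shows "spectral_mat U (\<chi> i. h (l $ i)) = spectral_mat V (\<chi> i. h (m $ i))"
proof -
  \<comment> \<open>\<open>W\<close> intertwines the two diagonal matrices, so \<open>W $ i $ j\<close> vanishes unless \<open>l $ j = m $ i\<close>.\<close>
  define W where "W = transpose V ** U"
  have VW: "V ** W = U"
    by (simp add: W_def matrix_mul_assoc orthogonal_matrix_cancel[OF V])
  have WU: "W ** transpose U = transpose V"
    by (metis W_def U matrix_mul_assoc matrix_mul_rid orthogonal_matrix_cancel(2))
  have "W ** diag_mat l = transpose V ** spectral_mat U l ** U"
    by (metis U W_def matrix_mul_assoc matrix_mul_rid orthogonal_matrix_cancel(1) spectral_mat_def)
  also have "\<dots> = diag_mat m ** W"
    by (metis V W_def eq matrix_mul_assoc matrix_mul_lid orthogonal_matrix_cancel(1) spectral_mat_def)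
  finally have comm: "W $ i $ j * l $ j = m $ i * W $ i $ j" for i j
    by (metis matrix_mult_diag diag_mult_matrix)
  have "W ** diag_mat (\<chi> i. h (l $ i)) = diag_mat (\<chi> i. h (m $ i)) ** W"
  proof -
    have "W $ i $ j * h (l $ j) = h (m $ i) * W $ i $ j" for i j
      using comm[of i j] by (cases "W $ i $ j = 0") auto
    then show ?thesis by (simp add: vec_eq_iff matrix_mult_diag diag_mult_matrix)
  qed
  then have "V ** (W ** diag_mat (\<chi> i. h (l $ i))) ** transpose U
    = V ** (diag_mat (\<chi> i. h (m $ i)) ** W) ** transpose U" by simp
  then show ?thesis
    by (metis VW WU matrix_mul_assoc spectral_mat_def)
qed

text \<open>Discharges the definite description: any other diagonalization of the same matrix gives
  the same result by \<open>spectral_mat_map_unique\<close> with \<open>h = abs\<close>.\<close>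

lemma matrix_abs_spectral_mat:
  assumes "orthogonal_matrix U"
  shows "matrix_abs (spectral_mat U l) = spectral_mat U (\<chi> i. \<bar>l $ i\<bar>)"
  unfolding matrix_abs_def
proof (rule the_equality)
  show "\<exists>V m. orthogonal_matrix V \<and> spectral_mat U l = V ** diag_mat m ** transpose V \<and>
     spectral_mat U (\<chi> i. \<bar>l $ i\<bar>) = V ** diag_mat (\<chi> i. \<bar>m $ i\<bar>) ** transpose V"
    using assms by (intro exI[of _ U] exI[of _ l]) (simp add: spectral_mat_def)
next
  fix B assume "\<exists>V m. orthogonal_matrix V \<and> spectral_mat U l = V ** diag_mat m ** transpose V \<and>
     B = V ** diag_mat (\<chi> i. \<bar>m $ i\<bar>) ** transpose V"
  then show "B = spectral_mat U (\<chi> i. \<bar>l $ i\<bar>)"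
    using spectral_mat_map_unique[OF assms, of _ l _ abs] by (metis spectral_mat_def)
qed

text \<open>Both branches keep the eigenvectors of \<open>H\<close>, because a multiple of the
  identity is diagonal in every orthonormal basis. The shift lifts the smallest absolute eigenvalue
  exactly to \<mu>t.\<close>

lemma modified_hess_spectral:
  fixes H :: "real^'n^'n"
  assumes "transpose H = H"
  obtains U m where "orthogonal_matrix U" "modified_hess \<mu>t H = spectral_mat U m" "\<And>i. \<mu>t \<le> m $ i"
proof -
  obtain U l where U: "orthogonal_matrix U" and H: "H = spectral_mat U l"
    using symmetric_matrix_spectral[OF assms] .
  let ?a = "(\<chi> i. \<bar>l $ i\<bar>) :: real^'n"
  have abs: "matrix_abs H = spectral_mat U ?a"
    using U H matrix_abs_spectral_mat by metis
  have min: "lambda_min (matrix_abs H) \<le> \<bar>l $ i\<bar>" for i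
    unfolding lambda_min_def abs eigenvalues_spectral_mat[OF U] by (rule Min_le) auto
  show ?thesis
  proof (cases "\<mu>t \<le> lambda_min (matrix_abs H)")
    case True
    then show ?thesis using that[OF U, of ?a] min order_trans
      by (simp add: modified_hess_def abs) blast
  next
    case False
    let ?c = "\<mu>t - lambda_min (matrix_abs H)"
    have "modified_hess \<mu>t H = spectral_mat U ?a + spectral_mat U (\<chi> i. ?c)"
      using False by (simp add: modified_hess_def spectral_mat_const[OF U] flip: abs)
    then have "modified_hess \<mu>t H = spectral_mat U (?a + (\<chi> i. ?c))"
      by (simp add: spectral_mat_add)
    moreover have "\<mu>t \<le> (?a + (\<chi> i. ?c)) $ i" for i using min[of i] by simp
    ultimately show ?thesis using that U by blast
  qed
qed

lemma matrix_inv_spectral_mat: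
  assumes U: "orthogonal_matrix U" and m: "\<And>i. m $ i \<noteq> 0"
  shows "invertible (spectral_mat U m)"
    and "matrix_inv (spectral_mat U m) = spectral_mat U (\<chi> i. 1 / m $ i)"
proof -
  have 1: "spectral_mat U m ** spectral_mat U (\<chi> i. 1 / m $ i) = mat 1"
    using m spectral_mat_const[OF U, of 1] by (simp add: spectral_mat_mult[OF U])
  then show "invertible (spectral_mat U m)"
    by (auto simp: invertible_right_inverse)
  then have "matrix_inv (spectral_mat U m) ** spectral_mat U m = mat 1"
    unfolding matrix_inv_def invertible_def by (rule someI2_ex) auto
  then show "matrix_inv (spectral_mat U m) = spectral_mat U (\<chi> i. 1 / m $ i)"
    using 1 by (metis matrix_mul_assoc matrix_mul_lid matrix_mul_rid)
qed

text \<open>No upper bound on the spectrum enters, so this is available at every sample point and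
  not just almost surely; measurability of the inverse relies on that.\<close>

lemma modified_hess_invertible:
  fixes H :: "real^'n^'n"
  assumes "transpose H = H" "\<mu>t > 0"
  shows "invertible (modified_hess \<mu>t H)"
  using modified_hess_spectral[OF assms(1), of \<mu>t] matrix_inv_spectral_mat(1) assms(2)
  by (metis less_le_not_le)

lemma modified_hess_inverse_bounds:
  fixes H :: "real^'n^'n"
  assumes sym: "transpose H = H" and \<mu>t: "\<mu>t > 0" and le: "modified_hess \<mu>t H \<preceq>\<^sub>L Lt *\<^sub>R mat 1"
  defines "P \<equiv> matrix_inv (modified_hess \<mu>t H)"
  shows "\<mu>t \<le> Lt"
    and "x \<bullet> (P *v y) = (P *v x) \<bullet> y"
    and "(x \<bullet> x) / Lt \<le> x \<bullet> (P *v x)"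
    and "x \<bullet> (P *v x) \<le> (x \<bullet> x) / \<mu>t"
    and "(P *v x) \<bullet> (P *v x) \<le> (x \<bullet> (P *v x)) / \<mu>t"
proof -
  obtain U m where U: "orthogonal_matrix U" and B: "modified_hess \<mu>t H = spectral_mat U m"
    and m: "\<And>i. \<mu>t \<le> m $ i"
    using modified_hess_spectral[OF sym, of \<mu>t] by blast
  have m0: "m $ i > 0" for i using m[of i] \<mu>t by linarith
  have P: "P = spectral_mat U (\<chi> i. 1 / m $ i)"
    unfolding P_def B using m0 by (intro matrix_inv_spectral_mat U) (metis less_irrefl)
  \<comment> \<open>Testing the Loewner bound on a column of \<open>U\<close>, a unit eigenvector,
    isolates one eigenvalue.\<close>
  have mL: "m $ i \<le> Lt" for i
  proof -
    have "0 \<le> column i U \<bullet> ((Lt *\<^sub>R mat 1 - spectral_mat U m) *v column i U)"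
      using le unfolding loewner_le_def B by blast
    also have "(Lt *\<^sub>R mat 1 - spectral_mat U m) *v column i U = (Lt - m $ i) *\<^sub>R column i U"
      by (simp add: matrix_vector_mult_diff_rdistrib spectral_mat_column[OF U]
          scaleR_left_diff_distrib flip: scaleR_matrix_vector_assoc)
    finally show ?thesis
      using U by (simp add: orthogonal_matrix_orthonormal_columns norm_eq_1)
  qed
  show "\<mu>t \<le> Lt" using m mL order_trans by blast
  show symP: "x \<bullet> (P *v y) = (P *v x) \<bullet> y" for x y
    unfolding P by (intro symmetric_matrix_inner transpose_spectral_mat)
  have const: "x \<bullet> (spectral_mat U (\<chi> i. c) *v x) = c * (x \<bullet> x)" for x c
    by (simp add: spectral_mat_const[OF U] flip: scaleR_matrix_vector_assoc)
  have lo: "1 / Lt \<le> 1 / m $ i" and hi: "1 / m $ i \<le> 1 / \<mu>t" for i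
    using m m0 mL \<mu>t by (auto intro!: divide_left_mono mult_pos_pos intro: less_le_trans)
  show "(x \<bullet> x) / Lt \<le> x \<bullet> (P *v x)"
    using spectral_mat_inner_mono[of "\<chi> i. 1 / Lt" "\<chi> i. 1 / m $ i" x U] lo
    by (simp add: const P)
  show "x \<bullet> (P *v x) \<le> (x \<bullet> x) / \<mu>t"
    using spectral_mat_inner_mono[of "\<chi> i. 1 / m $ i" "\<chi> i. 1 / \<mu>t" x U] hi
    by (simp add: const P)
  \<comment> \<open>Only one of the two factors \<open>1 / m $ i\<close> is replaced by its bound
    \<open>1 / \<mu>t\<close>, so that the quadratic form of \<open>P\<close> survives on the
    right.\<close>
  have "(P *v x) \<bullet> (P *v x) = x \<bullet> ((P ** P) *v x)"
    using symP[of x "P *v x"] by (simp add: matrix_vector_mul_assoc)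
  also have "\<dots> = (\<Sum>i\<in>UNIV. (1 / m $ i) * (1 / m $ i) * ((transpose U *v x) $ i)\<^sup>2)"
    by (simp add: P spectral_mat_mult[OF U] spectral_mat_inner)
  also have "\<dots> \<le> (\<Sum>i\<in>UNIV. (1 / m $ i) * (1 / \<mu>t) * ((transpose U *v x) $ i)\<^sup>2)"
    using m0 hi by (intro sum_mono mult_right_mono mult_left_mono) (auto simp: less_imp_le)
  also have "\<dots> = (x \<bullet> (P *v x)) / \<mu>t"
    by (simp add: P spectral_mat_inner sum_divide_distrib algebra_simps)
  finally show "(P *v x) \<bullet> (P *v x) \<le> (x \<bullet> (P *v x)) / \<mu>t" .
qed

section \<open>Second-order calculus\<close>

text \<open>The derivative is a linear functional, represented by \<open>adjoint D 1\<close>; the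
  representing vector is unique, which is what the definite description in \<open>grad\<close>
  requires.\<close>

lemma has_derivative_grad:
  assumes "f differentiable (at x)"
  shows "(f has_derivative (\<lambda>h. h \<bullet> grad f x)) (at x)"
proof -
  obtain D where D: "(f has_derivative D) (at x)" using assms by (auto simp: differentiable_def)
  then have "linear D" by (rule has_derivative_linear)
  then have eq: "(\<lambda>h. h \<bullet> adjoint D 1) = D" using adjoint_works[of D _ 1] by auto
  have adj: "GDERIV f x :> adjoint D 1" unfolding gderiv_def eq by (rule D)
  have uniq: "v = u" if "GDERIV f x :> v" "GDERIV f x :> u" for u v
  proof -
    have "(\<lambda>h. h \<bullet> v) = (\<lambda>h. h \<bullet> u)"
      using that has_derivative_unique unfolding gderiv_def by blast
    then show "v = u" by (simp add: fun_eq_iff vector_eq_ldot)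
  qed
  have "GDERIV f x :> grad f x"
    unfolding grad_def by (rule theI[where P="\<lambda>v. GDERIV f x :> v", OF adj uniq[OF _ adj]])
  then show ?thesis by (simp add: gderiv_def)
qed

lemma grad_eqI:
  assumes "(f has_derivative (\<lambda>h. h \<bullet> v)) (at x)"
  shows "grad f x = v"
proof -
  have "(f has_derivative (\<lambda>h. h \<bullet> grad f x)) (at x)"
    using assms by (intro has_derivative_grad) (auto simp: differentiable_def)
  from has_derivative_unique[OF this assms] show ?thesis by (simp add: fun_eq_iff vector_eq_ldot)
qed

lemma twice_diff_grad:
  assumes "twice_diff f"
  shows "(f has_derivative (\<lambda>h. h \<bullet> grad f x)) (at x)"
  using assms by (intro has_derivative_grad) (auto simp: twice_diff_def)

lemma twice_diff_hess:
  assumes "twice_diff f"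
  shows "(grad f has_derivative (\<lambda>h. hess f x *v h)) (at x)"
  using assms unfolding hess_def twice_diff_def by (metis jacobian_works)

lemma twice_diff_field_derivs:
  assumes "twice_diff f"
  shows "((\<lambda>t. f (x + t *\<^sub>R d)) has_real_derivative d \<bullet> grad f (x + t *\<^sub>R d)) (at t)"
    and "((\<lambda>t. u \<bullet> grad f (x + t *\<^sub>R d)) has_real_derivative u \<bullet> (hess f (x + t *\<^sub>R d) *v d)) (at t)"
proof -
  have line: "((\<lambda>t. x + t *\<^sub>R d) has_derivative (\<lambda>h. h *\<^sub>R d)) (at t)"
    by (auto intro!: derivative_eq_intros)
  show "((\<lambda>t. f (x + t *\<^sub>R d)) has_real_derivative d \<bullet> grad f (x + t *\<^sub>R d)) (at t)"
    using has_derivative_compose[OF line twice_diff_grad[OF assms]]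
    by (simp add: has_field_derivative_def mult_commute_abs)
  have "((\<lambda>t. u \<bullet> grad f (x + t *\<^sub>R d)) has_derivative (\<lambda>h. u \<bullet> (hess f (x + t *\<^sub>R d) *v (h *\<^sub>R d)))) (at t)"
    by (intro has_derivative_inner_right has_derivative_compose[OF line twice_diff_hess[OF assms]])
  then show "((\<lambda>t. u \<bullet> grad f (x + t *\<^sub>R d)) has_real_derivative u \<bullet> (hess f (x + t *\<^sub>R d) *v d)) (at t)"
    by (simp add: has_field_derivative_def mult_commute_abs matrix_vector_mult_scaleR)
qed

lemma twice_diff_taylor:
  assumes "twice_diff f"
  obtains y where "f (x + d) = f x + d \<bullet> grad f x + (d \<bullet> (hess f y *v d)) / 2"
proof -
  \<comment> \<open>The derivatives of \<open>f\<close> along the segment, in the form that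
    \<open>Maclaurin2\<close> expects. Order 2 at the endpoint 1 leaves the Lagrange remainder, with
    the Hessian at a single intermediate point, so uniform Hessian bounds transfer directly.\<close>
  define D where "D m t = (if m = 0 then f (x + t *\<^sub>R d) else if m = 1 then d \<bullet> grad f (x + t *\<^sub>R d)
     else d \<bullet> (hess f (x + t *\<^sub>R d) *v d))" for m :: nat and t
  have "D 0 = (\<lambda>t. f (x + t *\<^sub>R d))" "D 1 = (\<lambda>t. d \<bullet> grad f (x + t *\<^sub>R d))"
    by (auto simp: D_def)
  then have "DERIV (D m) t :> D (Suc m) t" if "m < 2" for m t
    using that twice_diff_field_derivs[OF assms] by (auto simp: less_2_cases_iff D_def)
  then obtain t where "D 0 1 = (\<Sum>m<2. D m 0 / fact m * 1 ^ m) + D 2 t / fact 2 * 1 ^ 2"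
    using Maclaurin2[of 1 D "D 0" 2] by auto
  then show ?thesis using that by (simp add: D_def numeral_2_eq_2)
qed

lemma loewner_le_scaleR_mat_1:
  "A \<preceq>\<^sub>L c *\<^sub>R mat 1 \<longleftrightarrow> (\<forall>v. v \<bullet> (A *v v) \<le> c * (v \<bullet> v))"
  "c *\<^sub>R mat 1 \<preceq>\<^sub>L A \<longleftrightarrow> (\<forall>v. c * (v \<bullet> v) \<le> v \<bullet> (A *v v))"
  by (simp_all add: loewner_le_def matrix_vector_mult_diff_rdistrib inner_diff_right
      flip: scaleR_matrix_vector_assoc)

lemma quadratic_upper_bound:
  assumes "twice_diff f" and "\<And>x. hess f x \<preceq>\<^sub>L c *\<^sub>R mat 1"
  shows "f y \<le> f x + (y - x) \<bullet> grad f x + c / 2 * (norm (y - x))\<^sup>2"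
proof -
  obtain z where "f (x + (y - x)) = f x + (y - x) \<bullet> grad f x + ((y - x) \<bullet> (hess f z *v (y - x))) / 2"
    using twice_diff_taylor[OF assms(1)] .
  moreover have "(y - x) \<bullet> (hess f z *v (y - x)) \<le> c * (norm (y - x))\<^sup>2"
    using assms(2)[of z] by (simp add: loewner_le_scaleR_mat_1 dot_square_norm)
  ultimately show ?thesis by simp
qed

lemma quadratic_lower_bound:
  assumes "twice_diff f" and "\<And>x. c *\<^sub>R mat 1 \<preceq>\<^sub>L hess f x"
  shows "f x + (y - x) \<bullet> grad f x + c / 2 * (norm (y - x))\<^sup>2 \<le> f y"
proof -
  obtain z where "f (x + (y - x)) = f x + (y - x) \<bullet> grad f x + ((y - x) \<bullet> (hess f z *v (y - x))) / 2"
    using twice_diff_taylor[OF assms(1)] .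
  moreover have "c * (norm (y - x))\<^sup>2 \<le> (y - x) \<bullet> (hess f z *v (y - x))"
    using assms(2)[of z] by (simp add: loewner_le_scaleR_mat_1 dot_square_norm)
  ultimately show ?thesis by simp
qed

text \<open>The mixed second difference over the parallelogram with sides
  \<open>t *\<^sub>R u\<close> and \<open>t *\<^sub>R v\<close> recovers the Hessian form up to
  \<open>o(t\<^sup>2)\<close>. The estimate comes from the first-order expansion of
  \<open>grad f\<close> at \<open>a\<close>.\<close>

lemma second_difference_bound:
  fixes f :: "real^'n \<Rightarrow> real"
  assumes f: "twice_diff f" and e: "e > 0"
  obtains \<delta> where "\<delta> > 0" "\<And>t. 0 < t \<Longrightarrow> t < \<delta> \<Longrightarrow>
    \<bar>f (a + t *\<^sub>R u + t *\<^sub>R v) - f (a + t *\<^sub>R u) - f (a + t *\<^sub>R v) + f a - t\<^sup>2 * (u \<bullet> (hess f a *v v))\<bar> \<le> e * t\<^sup>2"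
proof -
  define N where "N = norm u + norm v + 1"
  have N: "N > 0" by (simp add: N_def add_nonneg_pos)
  \<comment> \<open>Tuned to the final estimate: two gradient errors of size
    \<open>e' * (t * N)\<close>, paired with \<open>u\<close> of norm at most \<open>N\<close>, add
    up to \<open>e * t\<close>.\<close>
  define e' where "e' = e / (2 * N * N)"
  have e': "e' > 0" using e N by (simp add: e'_def)
  obtain r where r: "r > 0" and
    dr: "\<And>y. norm (y - a) < r \<Longrightarrow> norm (grad f y - grad f a - hess f a *v (y - a)) \<le> e' * norm (y - a)"
    using twice_diff_hess[OF f, of a] e' unfolding has_derivative_at_alt by meson
  show ?thesis
  proof (rule that[of "r / N"])
    show "r / N > 0" using r N by simp
    fix t assume t: "0 < t" "t < r / N"
    then have tN: "t * N < r" using N by (simp add: field_simps)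
    have small: "norm (grad f (a + h) - grad f a - hess f a *v h) \<le> e' * (t * N)" if "norm h \<le> t * N" for h
    proof -
      have "norm (grad f (a + h) - grad f a - hess f a *v h) \<le> e' * norm h"
        using dr[of "a + h"] that tN by simp
      also have "\<dots> \<le> e' * (t * N)" using that e' by (intro mult_left_mono) auto
      finally show ?thesis .
    qed
    \<comment> \<open>The second difference is the increment of \<open>p\<close> from 0 to
      \<open>t\<close>; the mean value theorem turns it into a difference of two gradients, taken at
      points within distance \<open>t * N\<close> of \<open>a\<close>.\<close>
    define p where "p s = f (a + t *\<^sub>R v + s *\<^sub>R u) - f (a + s *\<^sub>R u)" for s
    have "DERIV p s :> u \<bullet> grad f (a + t *\<^sub>R v + s *\<^sub>R u) - u \<bullet> grad f (a + s *\<^sub>R u)" for s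
      unfolding p_def by (intro DERIV_diff twice_diff_field_derivs[OF f])
    then obtain s where s: "0 < s" "s < t"
      and ps: "p t - p 0 = (t - 0) * (u \<bullet> grad f (a + t *\<^sub>R v + s *\<^sub>R u) - u \<bullet> grad f (a + s *\<^sub>R u))"
      using MVT2[OF t(1), of p "\<lambda>s. u \<bullet> grad f (a + t *\<^sub>R v + s *\<^sub>R u) - u \<bullet> grad f (a + s *\<^sub>R u)"] by blast
    define h1 where "h1 = t *\<^sub>R v + s *\<^sub>R u"
    define h2 where "h2 = s *\<^sub>R u"
    have "norm h2 \<le> t * norm u" using s t by (simp add: h2_def mult_right_mono)
    moreover have "norm h1 \<le> t * norm v + s * norm u"
      unfolding h1_def using s t by (intro norm_triangle_le) simp
    moreover have "s * norm u \<le> t * norm u" using s by (simp add: mult_right_mono)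
    moreover have "t * N = t * norm u + t * norm v + t" by (simp add: N_def algebra_simps)
    moreover have "0 \<le> t * norm v" using t by simp
    ultimately have h12: "norm h1 \<le> t * N" "norm h2 \<le> t * N" using t by linarith+
    define e1 where "e1 = grad f (a + h1) - grad f a - hess f a *v h1"
    define e2 where "e2 = grad f (a + h2) - grad f a - hess f a *v h2"
    have "norm (e1 - e2) \<le> e' * (t * N) + e' * (t * N)"
      using small[OF h12(1)] small[OF h12(2)] norm_triangle_ineq4[of e1 e2]
      unfolding e1_def e2_def by linarith
    then have "norm u * norm (e1 - e2) \<le> N * (e' * (t * N) + e' * (t * N))"
      using N t e' by (intro mult_mono) (auto simp: N_def)
    also have "\<dots> = e * t" using N by (simp add: e'_def field_simps)
    finally have err: "\<bar>u \<bullet> (e1 - e2)\<bar> \<le> e * t"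
      using Cauchy_Schwarz_ineq2[of u "e1 - e2"] by linarith
    \<comment> \<open>The two displacements differ by \<open>t *\<^sub>R v\<close>, so the linear
      parts leave exactly \<open>t\<close> times the Hessian applied to \<open>v\<close>.\<close>
    have "hess f a *v h1 = hess f a *v (t *\<^sub>R v) + hess f a *v h2"
      by (simp add: h1_def h2_def matrix_vector_right_distrib)
    then have "grad f (a + h1) - grad f (a + h2) = t *\<^sub>R (hess f a *v v) + (e1 - e2)"
      by (simp add: e1_def e2_def matrix_vector_mult_scaleR)
    then have ud: "u \<bullet> grad f (a + h1) - u \<bullet> grad f (a + h2) = t * (u \<bullet> (hess f a *v v)) + u \<bullet> (e1 - e2)"
      by (metis inner_add_right inner_diff_right inner_scaleR_right)
    have ah: "a + t *\<^sub>R v + s *\<^sub>R u = a + h1" "a + s *\<^sub>R u = a + h2"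
      by (simp_all add: h1_def h2_def add.assoc)
    have "p t - p 0 = t * (t * (u \<bullet> (hess f a *v v)) + u \<bullet> (e1 - e2))"
      using ps unfolding ah ud by simp
    then have "p t - p 0 - t\<^sup>2 * (u \<bullet> (hess f a *v v)) = t * (u \<bullet> (e1 - e2))"
      by (simp add: algebra_simps power2_eq_square)
    moreover have "\<bar>t * (u \<bullet> (e1 - e2))\<bar> \<le> t * (e * t)"
      using err t by (simp add: abs_mult)
    moreover have "p t - p 0 = f (a + t *\<^sub>R u + t *\<^sub>R v) - f (a + t *\<^sub>R u) - f (a + t *\<^sub>R v) + f a"
      by (simp add: p_def algebra_simps)
    ultimately show "\<bar>f (a + t *\<^sub>R u + t *\<^sub>R v) - f (a + t *\<^sub>R u) - f (a + t *\<^sub>R v) + f a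
       - t\<^sup>2 * (u \<bullet> (hess f a *v v))\<bar> \<le> e * t\<^sup>2"
      by (simp add: power2_eq_square algebra_simps)
  qed
qed

text \<open>The second difference does not change when \<open>u\<close> and \<open>v\<close> are
  swapped. If the two Hessian values differed by \<open>d > 0\<close>, errors of
  \<open>d / 3\<close> for each order would leave at most \<open>2 * d / 3\<close> between
  them.\<close>

lemma hess_symmetric:
  fixes f :: "real^'n \<Rightarrow> real"
  assumes f: "twice_diff f"
  shows "transpose (hess f a) = hess f a"
proof -
  have sym: "u \<bullet> (hess f a *v v) = v \<bullet> (hess f a *v u)" for u v
  proof (rule ccontr)
    define d where "d = \<bar>u \<bullet> (hess f a *v v) - v \<bullet> (hess f a *v u)\<bar>"
    assume "u \<bullet> (hess f a *v v) \<noteq> v \<bullet> (hess f a *v u)"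
    then have "d / 3 > 0" by (simp add: d_def)
    obtain d1 where d1: "d1 > 0" "\<And>t. 0 < t \<Longrightarrow> t < d1 \<Longrightarrow>
      \<bar>f (a + t *\<^sub>R u + t *\<^sub>R v) - f (a + t *\<^sub>R u) - f (a + t *\<^sub>R v) + f a - t\<^sup>2 * (u \<bullet> (hess f a *v v))\<bar> \<le> d / 3 * t\<^sup>2"
      using second_difference_bound[OF f \<open>d / 3 > 0\<close>] by metis
    obtain d2 where d2: "d2 > 0" "\<And>t. 0 < t \<Longrightarrow> t < d2 \<Longrightarrow>
      \<bar>f (a + t *\<^sub>R v + t *\<^sub>R u) - f (a + t *\<^sub>R v) - f (a + t *\<^sub>R u) + f a - t\<^sup>2 * (v \<bullet> (hess f a *v u))\<bar> \<le> d / 3 * t\<^sup>2"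
      using second_difference_bound[OF f \<open>d / 3 > 0\<close>] by metis
    define t where "t = min d1 d2 / 2"
    have t: "0 < t" "t < d1" "t < d2" using d1(1) d2(1) by (auto simp: t_def min_def)
    have comm: "a + t *\<^sub>R v + t *\<^sub>R u = a + t *\<^sub>R u + t *\<^sub>R v" by (simp add: algebra_simps)
    have "\<bar>t\<^sup>2 * (u \<bullet> (hess f a *v v)) - t\<^sup>2 * (v \<bullet> (hess f a *v u))\<bar> \<le> d / 3 * t\<^sup>2 + d / 3 * t\<^sup>2"
      using d1(2)[OF t(1,2)] d2(2)[OF t(1,3), unfolded comm] by linarith
    moreover have "\<bar>t\<^sup>2 * (u \<bullet> (hess f a *v v)) - t\<^sup>2 * (v \<bullet> (hess f a *v u))\<bar> = t\<^sup>2 * d"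
      unfolding d_def by (simp add: abs_mult flip: right_diff_distrib)
    moreover have "t\<^sup>2 * d > 0" using t \<open>d / 3 > 0\<close> by simp
    ultimately show False by (simp add: mult.commute)
  qed
  have "hess f a $ i $ j = hess f a $ j $ i" for i j
    using sym[of "axis i 1" "axis j 1"]
    by (simp add: inner_axis' matrix_vector_mult_basis column_def)
  then show ?thesis by (simp add: transpose_def vec_eq_iff)
qed

section \<open>Closure of twice differentiability under sample averages\<close>

lemma twice_diff_const: "twice_diff (\<lambda>x :: real^'n. c)"
proof -
  have "grad (\<lambda>x :: real^'n. c) = (\<lambda>x. 0)"
    by (intro ext grad_eqI) (auto intro!: derivative_eq_intros)
  then show ?thesis by (simp add: twice_diff_def)
qed

lemma twice_diff_add:
  assumes "twice_diff f" "twice_diff g"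
  shows "twice_diff (\<lambda>x. f x + g x)"
proof -
  have "grad (\<lambda>x. f x + g x) = (\<lambda>x. grad f x + grad g x)"
    using assms[THEN twice_diff_grad]
    by (intro ext grad_eqI) (auto intro!: derivative_eq_intros simp: inner_add_right)
  then show ?thesis using assms by (simp add: twice_diff_def)
qed

lemma twice_diff_cmult:
  assumes "twice_diff f"
  shows "twice_diff (\<lambda>x. c * f x)"
proof -
  have "grad (\<lambda>x. c * f x) = (\<lambda>x. c *\<^sub>R grad f x)"
    using assms[THEN twice_diff_grad]
    by (intro ext grad_eqI) (auto intro!: derivative_eq_intros)
  then show ?thesis using assms by (simp add: twice_diff_def)
qed

lemma twice_diff_sum:
  assumes "\<And>i. i \<in> T \<Longrightarrow> twice_diff (f i)"
  shows "twice_diff (\<lambda>x. \<Sum>i\<in>T. f i x)"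
  using assms by (induction T rule: infinite_finite_induct) (auto intro: twice_diff_const twice_diff_add)

lemma twice_diff_sample_avg:
  assumes "\<And>i. i \<in> T \<Longrightarrow> twice_diff (\<lambda>x. F x (\<zeta> i \<omega>))"
  shows "twice_diff (sample_avg F \<zeta> T \<omega>)"
  unfolding sample_avg_def[abs_def] using assms by (intro twice_diff_cmult twice_diff_sum)

lemma transpose_hess_avg:
  assumes "\<And>i. twice_diff (\<lambda>x. F x (\<zeta> i \<omega>))"
  shows "transpose (hess_avg F \<zeta> S \<gamma> w k \<omega>) = hess_avg F \<zeta> S \<gamma> w k \<omega>"
proof -
  have "hess (sample_avg F \<zeta> T \<omega>) x $ i $ j = hess (sample_avg F \<zeta> T \<omega>) x $ j $ i" for T x i j
    using hess_symmetric[OF twice_diff_sample_avg[of T F \<zeta> \<omega>], of x] assms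
    by (simp add: transpose_def vec_eq_iff)
  then show ?thesis by (simp add: hess_avg_def transpose_def vec_eq_iff)
qed

text \<open>Differentiation under the integral sign is avoided: for a fixed sample the Hessian bound is
  turned into an inequality between three function values, which survives integration, and the
  gradient of \<open>f\<close> reappears as the limit of difference quotients.\<close>

lemma quadratic_upper_bound_expectation:
  fixes G :: "real^'n \<Rightarrow> 'a \<Rightarrow> real"
  assumes M: "prob_space M" and int: "\<And>x. integrable M (G x)"
    and G: "AE \<omega> in M. twice_diff (\<lambda>x. G x \<omega>) \<and> (\<forall>x. hess (\<lambda>x. G x \<omega>) x \<preceq>\<^sub>L c *\<^sub>R mat 1)"
    and f: "\<And>x. f x = (\<integral>\<omega>. G x \<omega> \<partial>M)" and diff: "f differentiable (at x)"
  shows "f y \<le> f x + (y - x) \<bullet> grad f x + c / 2 * (norm (y - x))\<^sup>2"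
proof -
  interpret prob_space M by fact
  define d where "d = y - x"
  define D where "D = (norm d)\<^sup>2"
  \<comment> \<open>The quadratic bound is expanded at the intermediate point and used towards both
    ends with weights \<open>1 - t\<close> and \<open>t\<close>. The sample gradients cancel, and
    the quadratic terms combine through
    \<open>(1 - t) * t\<^sup>2 + t * (1 - t)\<^sup>2 = t * (1 - t)\<close>.\<close>
  have mid: "(1 - t) * f x + t * f y \<le> f (x + t *\<^sub>R d) + c / 2 * (t * (1 - t)) * D" if t: "0 < t" "t < 1" for t
  proof -
    have "AE \<omega> in M. (1 - t) * G x \<omega> + t * G y \<omega> \<le> G (x + t *\<^sub>R d) \<omega> + c / 2 * (t * (1 - t)) * D"
      using G
    proof eventually_elim
      case (elim \<omega>)
      define h where "h z = G z \<omega>" for z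
      define m where "m = x + t *\<^sub>R d"
      define q where "q = d \<bullet> grad h m"
      have h: "h z \<le> h m + (z - m) \<bullet> grad h m + c / 2 * (norm (z - m))\<^sup>2" for z
        using elim unfolding h_def by (intro quadratic_upper_bound) auto
      have xm: "x - m = (- t) *\<^sub>R d" and ym: "y - m = (1 - t) *\<^sub>R d"
        by (simp_all add: m_def d_def algebra_simps)
      have "h x \<le> h m - t * q + c / 2 * (t\<^sup>2 * D)"
        using h[of x] by (simp add: xm q_def D_def power_mult_distrib)
      then have "(1 - t) * h x \<le> (1 - t) * (h m - t * q + c / 2 * (t\<^sup>2 * D))"
        using t by (intro mult_left_mono) auto
      moreover have "h y \<le> h m + (1 - t) * q + c / 2 * ((1 - t)\<^sup>2 * D)"
        using h[of y] t by (simp add: ym q_def D_def power_mult_distrib)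
      then have "t * h y \<le> t * (h m + (1 - t) * q + c / 2 * ((1 - t)\<^sup>2 * D))"
        using t by (intro mult_left_mono) auto
      moreover have "(1 - t) * (h m - t * q + c / 2 * (t\<^sup>2 * D))
          + t * (h m + (1 - t) * q + c / 2 * ((1 - t)\<^sup>2 * D)) = h m + c / 2 * (t * (1 - t)) * D"
        by (simp add: field_simps power2_eq_square)
      ultimately have "(1 - t) * h x + t * h y \<le> h m + c / 2 * (t * (1 - t)) * D" by linarith
      then show ?case by (simp add: h_def m_def)
    qed
    then have "(\<integral>\<omega>. (1 - t) * G x \<omega> + t * G y \<omega> \<partial>M) \<le> (\<integral>\<omega>. G (x + t *\<^sub>R d) \<omega> + c / 2 * (t * (1 - t)) * D \<partial>M)"
      by (intro integral_mono_AE Bochner_Integration.integrable_add integrable_mult_right int) auto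
    then show ?thesis using int by (simp add: f prob_space)
  qed
  have "((\<lambda>t. f (x + t *\<^sub>R d)) has_derivative (\<lambda>h. (h *\<^sub>R d) \<bullet> grad f x)) (at 0)"
    using has_derivative_grad[OF diff]
    by (intro has_derivative_compose[where f="\<lambda>t. x + t *\<^sub>R d" and g=f]) (auto intro!: derivative_eq_intros)
  then have "((\<lambda>t. f (x + t *\<^sub>R d)) has_real_derivative d \<bullet> grad f x) (at 0)"
    by (simp add: has_field_derivative_def mult_commute_abs)
  then have "((\<lambda>t. (f (x + t *\<^sub>R d) - f x) / t) \<longlongrightarrow> d \<bullet> grad f x) (at_right 0)"
    by (auto simp: DERIV_def intro: tendsto_within_subset)
  then have "((\<lambda>t. f x + (f (x + t *\<^sub>R d) - f x) / t + c / 2 * (1 - t) * D) \<longlongrightarrow> f x + d \<bullet> grad f x + c / 2 * (1 - 0) * D) (at_right 0)"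
    by (intro tendsto_intros)
  \<comment> \<open>This is \<open>mid\<close> divided by \<open>t\<close>; in the limit the
    quotient becomes the directional derivative and the factor \<open>1 - t\<close> becomes
    1.\<close>
  moreover have "\<forall>\<^sub>F t in at_right 0. f y \<le> f x + (f (x + t *\<^sub>R d) - f x) / t + c / 2 * (1 - t) * D"
    using eventually_at_right_real[of 0 1, OF zero_less_one]
  proof eventually_elim
    case (elim t)
    then have t: "0 < t" "t < 1" by auto
    have "t * f y \<le> t * f x + (f (x + t *\<^sub>R d) - f x) + t * (c / 2 * (1 - t) * D)"
      using mid[OF t] by (simp add: algebra_simps)
    also have "\<dots> = t * (f x + (f (x + t *\<^sub>R d) - f x) / t + c / 2 * (1 - t) * D)"
      using t by (simp add: field_simps)
    finally show ?case using t by simp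
  qed
  ultimately have "f y \<le> f x + d \<bullet> grad f x + c / 2 * (1 - 0) * D"
    by (intro tendsto_lowerbound[where F="at_right 0"]) auto
  then show ?thesis by (simp add: d_def D_def)
qed

text \<open>The Polyak-Lojasiewicz inequality: the strongly convex lower bound at \<open>y\<close>,
  multiplied by \<open>2 * c\<close>, is completed to the square of
  \<open>grad f x + c *\<^sub>R d\<close>.\<close>

lemma gradient_dominated:
  assumes f: "twice_diff f" and c: "c > 0" and lower: "\<And>x. c *\<^sub>R mat 1 \<preceq>\<^sub>L hess f x"
  shows "2 * c * (f x - f y) \<le> (norm (grad f x))\<^sup>2"
proof -
  define d where "d = y - x"
  have "0 \<le> (norm (grad f x + c *\<^sub>R d))\<^sup>2" by simp
  also have "\<dots> = (norm (grad f x))\<^sup>2 + 2 * c * (d \<bullet> grad f x) + c\<^sup>2 * (norm d)\<^sup>2"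
    by (simp only: power2_norm_eq_inner)
      (simp add: inner_add_left inner_add_right inner_commute power2_eq_square)
  finally have "0 \<le> (norm (grad f x))\<^sup>2 + 2 * c * (d \<bullet> grad f x) + c\<^sup>2 * (norm d)\<^sup>2" .
  moreover have "2 * c * (f x + d \<bullet> grad f x + c / 2 * (norm d)\<^sup>2) \<le> 2 * c * f y"
    using quadratic_lower_bound[OF f lower, of x y] c by (intro mult_left_mono) (auto simp: d_def)
  ultimately show ?thesis by (simp add: algebra_simps power2_eq_square)
qed

text \<open>The upper bound is tested at the gradient step of length \<open>1 / c\<close>, where the
  value of \<open>f\<close> cannot fall below the minimum.\<close>

lemma grad_norm_le_gap:
  assumes c: "c > 0"
    and upper: "\<And>x y. f y \<le> f x + (y - x) \<bullet> grad f x + c / 2 * (norm (y - x))\<^sup>2"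
    and min: "\<And>y. f xmin \<le> f y"
  shows "(norm (grad f x))\<^sup>2 \<le> 2 * c * (f x - f xmin)"
proof -
  let ?g = "grad f x"
  have "f xmin \<le> f x + (x - (1 / c) *\<^sub>R ?g - x) \<bullet> ?g + c / 2 * (norm (x - (1 / c) *\<^sub>R ?g - x))\<^sup>2"
    using upper min order_trans by blast
  also have "\<dots> = f x - (norm ?g)\<^sup>2 / (2 * c)"
    using c by (simp add: power_mult_distrib dot_square_norm field_simps power2_eq_square)
  finally show ?thesis using c by (simp add: field_simps)
qed

section \<open>Measurability and conditional expectations\<close>

lemma borel_measurable_vec_iff:
  fixes f :: "'a \<Rightarrow> 'b::euclidean_space^'n"
  shows "f \<in> borel_measurable M \<longleftrightarrow> (\<forall>i. (\<lambda>x. f x $ i) \<in> borel_measurable M)"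
proof
  assume f: "f \<in> borel_measurable M"
  have "(\<lambda>v :: 'b^'n. v $ i) \<in> borel_measurable borel" for i
    by (intro borel_measurable_continuous_onI continuous_intros)
  then show "\<forall>i. (\<lambda>x. f x $ i) \<in> borel_measurable M"
    using measurable_compose[OF f] by blast
next
  assume f: "\<forall>i. (\<lambda>x. f x $ i) \<in> borel_measurable M"
  have "(\<lambda>x. f x \<bullet> b) \<in> borel_measurable M" if "b \<in> Basis" for b
  proof -
    obtain i c where b: "b = axis i c" using \<open>b \<in> Basis\<close> by (auto simp: Basis_vec_def)
    have "(\<lambda>x. (f x $ i) \<bullet> c) \<in> borel_measurable M"
      using f by (intro borel_measurable_inner borel_measurable_const) blast
    then show ?thesis by (simp add: b inner_axis)
  qed
  then show "f \<in> borel_measurable M" by (simp add: borel_measurable_euclidean_space[of f])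
qed

lemma borel_measurable_matrix_vector_mult [measurable (raw)]:
  fixes A :: "'a \<Rightarrow> real^'n^'m"
  assumes "A \<in> borel_measurable M" "v \<in> borel_measurable M"
  shows "(\<lambda>x. A x *v v x) \<in> borel_measurable M"
proof -
  have [measurable]: "(\<lambda>x. A x $ i $ j) \<in> borel_measurable M" "(\<lambda>x. v x $ j) \<in> borel_measurable M" for i j
    using assms by (simp_all add: borel_measurable_vec_iff)
  have "(\<lambda>x. (A x *v v x) $ i) \<in> borel_measurable M" for i
    unfolding matrix_vector_mult_def by simp
  then show ?thesis by (simp add: borel_measurable_vec_iff)
qed

lemma borel_measurable_det:
  fixes A :: "'a \<Rightarrow> real^'n^'n"
  assumes "\<And>i j. (\<lambda>x. A x $ i $ j) \<in> borel_measurable M"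
  shows "(\<lambda>x. det (A x)) \<in> borel_measurable M"
  unfolding det_def using assms by (intro borel_measurable_sum borel_measurable_times borel_measurable_prod) auto

text \<open>Cramer's rule makes the inverse an explicit rational function of the entries, from which
  its measurability can be read off.\<close>

lemma matrix_inv_component:
  fixes A :: "real^'n^'n"
  assumes "invertible A"
  shows "matrix_inv A $ i $ j = det (\<chi> k l. if l = i then axis j 1 $ k else A $ k $ l) / det A"
proof -
  have "A ** matrix_inv A = mat 1"
    using assms unfolding matrix_inv_def invertible_def by (rule someI2_ex) auto
  then have "A *v (matrix_inv A *v axis j 1) = axis j 1"
    by (simp add: matrix_vector_mul_assoc)
  then have "matrix_inv A *v axis j 1 = (\<chi> i. det (\<chi> k l. if l = i then axis j 1 $ k else A $ k $ l) / det A)"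
    using cramer[of A] assms by (simp add: invertible_det_nz)
  then show ?thesis
    by (simp add: matrix_vector_mult_basis column_def vec_eq_iff)
qed

lemma borel_measurable_matrix_inv:
  fixes A :: "'a \<Rightarrow> real^'n^'n"
  assumes A: "A \<in> borel_measurable M" and inv: "\<And>x. x \<in> space M \<Longrightarrow> invertible (A x)"
  shows "(\<lambda>x. matrix_inv (A x)) \<in> borel_measurable M"
proof -
  have [measurable]: "(\<lambda>x. A x $ i $ j) \<in> borel_measurable M" for i j
    using A by (simp add: borel_measurable_vec_iff)
  have "(\<lambda>x. matrix_inv (A x) $ i $ j) \<in> borel_measurable M" for i j
  proof -
    have "(\<lambda>x. matrix_inv (A x) $ i $ j) \<in> borel_measurable M \<longleftrightarrow>
      (\<lambda>x. det (\<chi> k l. if l = i then axis j 1 $ k else A x $ k $ l) / det (A x)) \<in> borel_measurable M"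
      by (rule measurable_cong) (simp add: matrix_inv_component inv)
    moreover have "(\<lambda>x. det (\<chi> k l. if l = i then axis j 1 $ k else A x $ k $ l) / det (A x)) \<in> borel_measurable M"
      by (intro borel_measurable_divide borel_measurable_det) auto
    ultimately show ?thesis by simp
  qed
  then show ?thesis by (simp add: borel_measurable_vec_iff)
qed

lemma borel_measurable_grad:
  assumes "twice_diff f"
  shows "grad f \<in> borel_measurable borel"
  using assms
  by (intro borel_measurable_continuous_onI continuous_at_imp_continuous_on)
    (auto simp: twice_diff_def intro: differentiable_imp_continuous_within)

lemma borel_measurable_twice_diff:
  assumes "twice_diff f"
  shows "f \<in> borel_measurable borel"
  using assms
  by (intro borel_measurable_continuous_onI continuous_at_imp_continuous_on)
    (auto simp: twice_diff_def intro: differentiable_imp_continuous_within)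

section \<open>The sigma-algebras of the history\<close>

lemma var_events_sets:
  assumes "X \<in> borel_measurable M"
  shows "var_events M X \<subseteq> sets M"
  using assms by (auto simp: var_events_def intro: measurable_sets)

lemma sample_events_sets:
  assumes "S k \<in> measurable M (count_space UNIV)" "\<And>i. \<zeta> i \<in> measurable M D"
  shows "sample_events M D \<zeta> S k \<subseteq> sets M"
proof -
  have "{\<omega> \<in> space M. S k \<omega> = T \<and> \<zeta> i \<omega> \<in> B} \<in> sets M" if "B \<in> sets D" for T i B
  proof -
    have "S k -` {T} \<inter> space M \<in> sets M" "\<zeta> i -` B \<inter> space M \<in> sets M"
      using assms that by (auto intro: measurable_sets)
    moreover have "{\<omega> \<in> space M. S k \<omega> = T \<and> \<zeta> i \<omega> \<in> B}
      = (S k -` {T} \<inter> space M) \<inter> (\<zeta> i -` B \<inter> space M)" by auto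
    ultimately show ?thesis by simp
  qed
  then show ?thesis by (auto simp: sample_events_def)
qed

lemma past_sets:
  assumes "\<And>k. S k \<in> measurable M (count_space UNIV)" "\<And>i. \<zeta> i \<in> measurable M D"
    and "\<And>k. g k \<in> borel_measurable M" "\<And>k. w k \<in> borel_measurable M"
  shows "sets (past M D \<zeta> S g w k) \<subseteq> sets M"
    and "var_events M (w k) \<subseteq> sets (past M D \<zeta> S g w k)"
proof -
  let ?E = "(\<Union>j\<le>k. var_events M (w j)) \<union> (\<Union>j<k. var_events M (g j)) \<union> (\<Union>j<k. sample_events M D \<zeta> S j)"
  have E: "?E \<subseteq> sets M"
    using var_events_sets[OF assms(3)] var_events_sets[OF assms(4)] sample_events_sets[where S=S and \<zeta>=\<zeta> and D=D, OF assms(1,2)]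
    by blast
  then have "?E \<subseteq> Pow (space M)" using sets.space_closed by blast
  then have eq: "sets (past M D \<zeta> S g w k) = sigma_sets (space M) ?E"
    unfolding past_def by simp
  show "sets (past M D \<zeta> S g w k) \<subseteq> sets M"
    unfolding eq by (rule sets.sigma_sets_subset[OF E])
  show "var_events M (w k) \<subseteq> sets (past M D \<zeta> S g w k)"
    unfolding eq by (rule subset_trans[OF _ sigma_sets_superset_generator]) auto
qed

text \<open>With \<open>X = Ht k\<close>, the last two facts make the exact quasi-Newton direction a
  known factor under the conditioning.\<close>

lemma history_subalgebra:
  assumes "\<And>k. S k \<in> measurable M (count_space UNIV)" "\<And>i. \<zeta> i \<in> measurable M D"
    and "\<And>k. g k \<in> borel_measurable M" "\<And>k. w k \<in> borel_measurable M"
    and "X \<in> borel_measurable M"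
  shows "subalgebra M (history M D \<zeta> S g w k X)"
    and "w k \<in> borel_measurable (history M D \<zeta> S g w k X)"
    and "X \<in> borel_measurable (history M D \<zeta> S g w k X)"
proof -
  let ?H = "history M D \<zeta> S g w k X"
  let ?E = "sets (past M D \<zeta> S g w k) \<union> var_events M X"
  note P = past_sets[where S=S and \<zeta>=\<zeta> and D=D and g=g and w=w and k=k, OF assms(1-4)]
  have E: "?E \<subseteq> sets M" using P(1) var_events_sets[OF assms(5)] by blast
  then have "?E \<subseteq> Pow (space M)" using sets.space_closed by blast
  then have H: "sets ?H = sigma_sets (space M) ?E" "space ?H = space M"
    unfolding history_def by simp_all
  show "subalgebra M ?H"
    unfolding subalgebra_def H using sets.sigma_sets_subset[OF E] by simp
  have meas: "Y \<in> borel_measurable ?H" if "var_events M Y \<subseteq> ?E" for Y :: "'a \<Rightarrow> 'e::topological_space"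
  proof (rule measurableI)
    fix B :: "'e set" assume "B \<in> sets borel"
    then have "Y -` B \<inter> space M \<in> ?E" using that by (auto simp: var_events_def)
    then show "Y -` B \<inter> space ?H \<in> sets ?H" unfolding H by (rule sigma_sets.Basic)
  qed simp
  show "w k \<in> borel_measurable ?H" using P(2) by (intro meas) auto
  show "X \<in> borel_measurable ?H" by (intro meas) auto
qed

lemma (in prob_space) sigma_finite_subalgebra_prob:
  assumes "subalgebra M N"
  shows "sigma_finite_subalgebra M N"
proof -
  interpret finite_measure_subalgebra M N using assms by unfold_locales
  show ?thesis by unfold_locales
qed

text \<open>\<open>nn_cond_exp\<close> preserves integrals with values in the extended reals, so
  \<open>X\<close> need not be known to be integrable beforehand; the integrable bound
  \<open>Y\<close> makes it so.\<close>

lemma nn_cond_exp_le_imp_integral_le: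
  fixes X Y :: "'a \<Rightarrow> real"
  assumes "sigma_finite_subalgebra M N" and X: "X \<in> borel_measurable M" "\<And>\<omega>. 0 \<le> X \<omega>"
    and Y: "integrable M Y" "AE \<omega> in M. 0 \<le> Y \<omega>"
    and le: "AE \<omega> in M. nn_cond_exp M N (\<lambda>\<omega>. ennreal (X \<omega>)) \<omega> \<le> ennreal (Y \<omega>)"
  shows "integrable M X" and "(\<integral>\<omega>. X \<omega> \<partial>M) \<le> (\<integral>\<omega>. Y \<omega> \<partial>M)"
proof -
  interpret sigma_finite_subalgebra M N by fact
  have "(\<integral>\<^sup>+\<omega>. ennreal (X \<omega>) \<partial>M) = (\<integral>\<^sup>+\<omega>. nn_cond_exp M N (\<lambda>\<omega>. ennreal (X \<omega>)) \<omega> \<partial>M)"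
    using nn_cond_exp_intg[of "\<lambda>_. 1" "\<lambda>\<omega>. ennreal (X \<omega>)"] X by simp
  also have "\<dots> \<le> (\<integral>\<^sup>+\<omega>. ennreal (Y \<omega>) \<partial>M)" by (rule nn_integral_mono_AE[OF le])
  also have "\<dots> = ennreal (\<integral>\<omega>. Y \<omega> \<partial>M)" by (rule nn_integral_eq_integral[OF Y])
  finally have *: "(\<integral>\<^sup>+\<omega>. ennreal (X \<omega>) \<partial>M) \<le> ennreal (\<integral>\<omega>. Y \<omega> \<partial>M)" .
  have "(\<integral>\<^sup>+\<omega>. ennreal (X \<omega>) \<partial>M) < \<infinity>"
    by (rule le_less_trans[OF *]) simp
  then show int: "integrable M X" using X by (intro integrableI_nonneg) auto
  have "ennreal (\<integral>\<omega>. X \<omega> \<partial>M) \<le> ennreal (\<integral>\<omega>. Y \<omega> \<partial>M)"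
    using * nn_integral_eq_integral[OF int] X(2) by simp
  moreover have "0 \<le> (\<integral>\<omega>. Y \<omega> \<partial>M)" by (rule integral_nonneg_AE[OF Y(2)])
  ultimately show "(\<integral>\<omega>. X \<omega> \<partial>M) \<le> (\<integral>\<omega>. Y \<omega> \<partial>M)" by simp
qed

lemma integrable_inner_L2:
  fixes X Y :: "'a \<Rightarrow> 'b::euclidean_space"
  assumes [measurable]: "X \<in> borel_measurable M" "Y \<in> borel_measurable M"
    and int: "integrable M (\<lambda>\<omega>. (norm (X \<omega>))\<^sup>2)" "integrable M (\<lambda>\<omega>. (norm (Y \<omega>))\<^sup>2)"
  shows "integrable M (\<lambda>\<omega>. X \<omega> \<bullet> Y \<omega>)"
proof (rule Bochner_Integration.integrable_bound[OF Bochner_Integration.integrable_add[OF int]])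
  show "(\<lambda>\<omega>. X \<omega> \<bullet> Y \<omega>) \<in> borel_measurable M" by measurable
  have "\<bar>X \<omega> \<bullet> Y \<omega>\<bar> \<le> (norm (X \<omega>))\<^sup>2 + (norm (Y \<omega>))\<^sup>2" for \<omega>
    using Cauchy_Schwarz_ineq2[of "X \<omega>" "Y \<omega>"] sum_squares_bound[of "norm (X \<omega>)" "norm (Y \<omega>)"]
      mult_nonneg_nonneg[OF norm_ge_zero[of "X \<omega>"] norm_ge_zero[of "Y \<omega>"]]
    by linarith
  then show "AE \<omega> in M. norm (X \<omega> \<bullet> Y \<omega>) \<le> norm ((norm (X \<omega>))\<^sup>2 + (norm (Y \<omega>))\<^sup>2)" by simp
qed

text \<open>The known factor \<open>Z\<close> is taken out coordinate by coordinate. Square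
  integrability of \<open>X\<close> and \<open>Z\<close> makes each product integrable; the products
  with \<open>Y\<close> inherit this from those with the conditional expectation.\<close>

lemma cond_unbiased_integral_inner:
  fixes X Y Z :: "'a \<Rightarrow> real^'n"
  assumes "sigma_finite_subalgebra M N" and XY: "cond_unbiased M N X Y"
    and X: "X \<in> borel_measurable M" and Y: "Y \<in> borel_measurable M" and Z: "Z \<in> borel_measurable N"
    and int: "integrable M (\<lambda>\<omega>. (norm (X \<omega>))\<^sup>2)" "integrable M (\<lambda>\<omega>. (norm (Z \<omega>))\<^sup>2)"
  shows "(\<integral>\<omega>. Z \<omega> \<bullet> X \<omega> \<partial>M) = (\<integral>\<omega>. Z \<omega> \<bullet> Y \<omega> \<partial>M)"
proof -
  interpret sigma_finite_subalgebra M N by fact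
  have ZM: "Z \<in> borel_measurable M" using Z subalg measurable_from_subalg by blast
  have Xi [measurable]: "(\<lambda>\<omega>. X \<omega> $ i) \<in> borel_measurable M" for i using X by (simp add: borel_measurable_vec_iff)
  have Yi [measurable]: "(\<lambda>\<omega>. Y \<omega> $ i) \<in> borel_measurable M" for i using Y by (simp add: borel_measurable_vec_iff)
  have Zi: "(\<lambda>\<omega>. Z \<omega> $ i) \<in> borel_measurable N" for i using Z by (simp add: borel_measurable_vec_iff)
  have ZiM [measurable]: "(\<lambda>\<omega>. Z \<omega> $ i) \<in> borel_measurable M" for i using ZM by (simp add: borel_measurable_vec_iff)
  have sq: "integrable M (\<lambda>\<omega>. (norm (V \<omega> $ i))\<^sup>2)"
    if "integrable M (\<lambda>\<omega>. (norm (V \<omega>))\<^sup>2)" "(\<lambda>\<omega>. V \<omega> $ i) \<in> borel_measurable M" for V :: "'a \<Rightarrow> real^'n" and i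
    using that(2) by (intro Bochner_Integration.integrable_bound[OF that(1)])
      (auto intro!: AE_I2 power_mono simp: component_le_norm_cart abs_le_square_iff[symmetric])
  have ZX: "integrable M (\<lambda>\<omega>. Z \<omega> $ i * X \<omega> $ i)" for i
    using integrable_inner_L2[of "\<lambda>\<omega>. Z \<omega> $ i" M "\<lambda>\<omega>. X \<omega> $ i"] sq int by simp
  have ae: "AE \<omega> in M. Z \<omega> $ i * real_cond_exp M N (\<lambda>\<omega>. X \<omega> $ i) \<omega> = Z \<omega> $ i * Y \<omega> $ i" for i
    using XY by (auto simp: cond_unbiased_def elim: eventually_mono)
  note R = real_cond_exp_intg[OF ZX Zi Xi]
  have ZY: "integrable M (\<lambda>\<omega>. Z \<omega> $ i * Y \<omega> $ i)" for i
    using R(1)[of i] ae[of i] by (subst integrable_cong_AE[symmetric]) auto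
  have eq: "(\<integral>\<omega>. Z \<omega> $ i * X \<omega> $ i \<partial>M) = (\<integral>\<omega>. Z \<omega> $ i * Y \<omega> $ i \<partial>M)" for i
    using R(2)[of i] integral_cong_AE[OF _ _ ae[of i]] by auto
  show ?thesis
    unfolding inner_vec_def inner_real_def using ZX ZY eq by (simp add: Bochner_Integration.integral_sum)
qed

section \<open>Quasi-Newton steps\<close>

text \<open>The properties of the inverse \<open>P\<close> of a symmetric matrix with spectrum in \<open>[\<mu>t, Lt]\<close> that the
  convergence analysis needs.\<close>

definition inverse_bounds :: "real \<Rightarrow> real \<Rightarrow> real^'n^'n \<Rightarrow> bool" where
  "inverse_bounds \<mu>t Lt P \<longleftrightarrow> (\<forall>x y. x \<bullet> (P *v y) = (P *v x) \<bullet> y) \<and>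
     (\<forall>x. (x \<bullet> x) / Lt \<le> x \<bullet> (P *v x)) \<and> (\<forall>x. x \<bullet> (P *v x) \<le> (x \<bullet> x) / \<mu>t) \<and>
     (\<forall>x. (P *v x) \<bullet> (P *v x) \<le> (x \<bullet> (P *v x)) / \<mu>t)"

text \<open>Strong convexity is represented by \<open>dominated\<close> and the sample Hessian bound
  by \<open>upper\<close>. The sampling of the Hessians is visible only through \<open>P\<close>,
  and conditioning is left to the individual lemmas, so both parts and both norms share the
  analysis.\<close>

locale quasi_newton = prob_space M for M :: "'a measure" +
  fixes f :: "real^'n \<Rightarrow> real" and xmin w0 :: "real^'n" and w g :: "nat \<Rightarrow> 'a \<Rightarrow> real^'n"
    and P :: "nat \<Rightarrow> 'a \<Rightarrow> real^'n^'n" and L Lt \<mu> \<mu>t \<alpha> :: real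
  assumes f: "twice_diff f"
    and upper: "\<And>x y. f y \<le> f x + (y - x) \<bullet> grad f x + L / 2 * (norm (y - x))\<^sup>2"
    and dominated: "\<And>x. 2 * \<mu> * (f x - f xmin) \<le> (norm (grad f x))\<^sup>2"
    and minimal: "\<And>x. f xmin \<le> f x"
    and \<mu>: "0 < \<mu>" "\<mu> \<le> L" and \<mu>t: "0 < \<mu>t" "\<mu>t \<le> Lt" and \<alpha>: "0 < \<alpha>"
    and P_bounds: "AE \<omega> in M. \<forall>k. inverse_bounds \<mu>t Lt (P k \<omega>)"
    and P_meas [measurable]: "\<And>k. P k \<in> borel_measurable M"
    and g_meas [measurable]: "\<And>k. g k \<in> borel_measurable M"
    and w_0: "\<And>\<omega>. \<omega> \<in> space M \<Longrightarrow> w 0 \<omega> = w0"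
    and w_Suc: "\<And>k \<omega>. \<omega> \<in> space M \<Longrightarrow> w (Suc k) \<omega> = w k \<omega> - \<alpha> *\<^sub>R (P k \<omega> *v g k \<omega>)"
begin

lemma L_pos: "0 < L" and Lt_pos: "0 < Lt"
  using \<mu> \<mu>t by auto

lemma w_meas [measurable]: "w k \<in> borel_measurable M"
proof (induction k)
  case 0
  have "w 0 \<in> borel_measurable M \<longleftrightarrow> (\<lambda>_. w0) \<in> borel_measurable M"
    by (rule measurable_cong) (rule w_0)
  then show ?case by simp
next
  case (Suc k)
  note [measurable] = Suc
  have "w (Suc k) \<in> borel_measurable M \<longleftrightarrow> (\<lambda>\<omega>. w k \<omega> - \<alpha> *\<^sub>R (P k \<omega> *v g k \<omega>)) \<in> borel_measurable M"
    by (rule measurable_cong) (rule w_Suc)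
  then show ?case by simp
qed

definition gap :: "nat \<Rightarrow> 'a \<Rightarrow> real" where
  "gap k \<omega> = f (w k \<omega>) - f xmin"

definition gr :: "nat \<Rightarrow> 'a \<Rightarrow> real^'n" where
  "gr k \<omega> = grad f (w k \<omega>)"

definition err :: "nat \<Rightarrow> 'a \<Rightarrow> real^'n" where
  "err k \<omega> = g k \<omega> - gr k \<omega>"

definition gr_sq :: "nat \<Rightarrow> 'a \<Rightarrow> real" where
  "gr_sq k \<omega> = gr k \<omega> \<bullet> (P k \<omega> *v gr k \<omega>)"

definition err_sq :: "nat \<Rightarrow> 'a \<Rightarrow> real" where
  "err_sq k \<omega> = err k \<omega> \<bullet> (P k \<omega> *v err k \<omega>)"

definition cross :: "nat \<Rightarrow> 'a \<Rightarrow> real" where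
  "cross k \<omega> = gr k \<omega> \<bullet> (P k \<omega> *v err k \<omega>)"

lemma gap_meas [measurable]: "gap k \<in> borel_measurable M"
  unfolding gap_def[abs_def] using borel_measurable_twice_diff[OF f] by measurable

lemma gr_meas [measurable]: "gr k \<in> borel_measurable M"
  unfolding gr_def[abs_def] using borel_measurable_grad[OF f] by measurable

lemma err_meas [measurable]: "err k \<in> borel_measurable M"
  unfolding err_def[abs_def] by measurable

lemma sq_meas [measurable]:
  "gr_sq k \<in> borel_measurable M" "err_sq k \<in> borel_measurable M" "cross k \<in> borel_measurable M"
  unfolding gr_sq_def[abs_def] err_sq_def[abs_def] cross_def[abs_def] by measurable

lemma gap_nonneg: "0 \<le> gap k \<omega>"
  by (simp add: gap_def minimal)

lemma inverse_boundsD: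
  assumes "inverse_bounds \<mu>t Lt Q"
  shows "x \<bullet> (Q *v y) = (Q *v x) \<bullet> y" and "(norm x)\<^sup>2 / Lt \<le> x \<bullet> (Q *v x)"
    and "x \<bullet> (Q *v x) \<le> (norm x)\<^sup>2 / \<mu>t" and "(norm (Q *v x))\<^sup>2 \<le> (x \<bullet> (Q *v x)) / \<mu>t"
    and "0 \<le> x \<bullet> (Q *v x)" and "(norm x)\<^sup>2 \<le> Lt * (x \<bullet> (Q *v x))"
proof -
  show "x \<bullet> (Q *v y) = (Q *v x) \<bullet> y" and 2: "(norm x)\<^sup>2 / Lt \<le> x \<bullet> (Q *v x)"
    and "x \<bullet> (Q *v x) \<le> (norm x)\<^sup>2 / \<mu>t" and "(norm (Q *v x))\<^sup>2 \<le> (x \<bullet> (Q *v x)) / \<mu>t"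
    using assms unfolding inverse_bounds_def power2_norm_eq_inner by blast+
  have "0 \<le> (norm x)\<^sup>2 / Lt" using Lt_pos by simp
  with 2 show "0 \<le> x \<bullet> (Q *v x)" by linarith
  show "(norm x)\<^sup>2 \<le> Lt * (x \<bullet> (Q *v x))" using 2 Lt_pos by (simp add: field_simps)
qed

text \<open>The second conjunct is the nonnegativity of
  \<open>g k \<omega> \<bullet> (P k \<omega> *v g k \<omega>)\<close>; it permits enlarging the
  coefficient in front of this expression.\<close>

lemma descent:
  "AE \<omega> in M. gap (Suc k) \<omega> \<le> gap k \<omega> - \<alpha> * (gr_sq k \<omega> + cross k \<omega>)
      + L * \<alpha>\<^sup>2 / (2 * \<mu>t) * (gr_sq k \<omega> + 2 * cross k \<omega> + err_sq k \<omega>)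
    \<and> 0 \<le> gr_sq k \<omega> + 2 * cross k \<omega> + err_sq k \<omega>"
  using P_bounds AE_space
proof eventually_elim
  case (elim \<omega>)
  let ?P = "P k \<omega>" and ?n = "gr k \<omega>" and ?e = "err k \<omega>" and ?g = "g k \<omega>"
  have B: "inverse_bounds \<mu>t Lt ?P" using elim by blast
  have ge: "?g = ?n + ?e" by (simp add: err_def)
  have nPg: "?n \<bullet> (?P *v ?g) = gr_sq k \<omega> + cross k \<omega>"
    by (simp add: ge gr_sq_def cross_def matrix_vector_right_distrib inner_add_right)
  have "?e \<bullet> (?P *v ?n) = cross k \<omega>"
    using inverse_boundsD(1)[OF B, of ?e ?n] by (simp add: cross_def inner_commute)
  then have gPg: "?g \<bullet> (?P *v ?g) = gr_sq k \<omega> + 2 * cross k \<omega> + err_sq k \<omega>"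
    by (simp add: ge gr_sq_def err_sq_def cross_def matrix_vector_right_distrib inner_add_right inner_add_left)
  have "w (Suc k) \<omega> - w k \<omega> = - (\<alpha> *\<^sub>R (?P *v ?g))" using w_Suc elim(2) by simp
  then have "f (w (Suc k) \<omega>) \<le> f (w k \<omega>) - \<alpha> * (?n \<bullet> (?P *v ?g)) + L / 2 * (\<alpha>\<^sup>2 * (norm (?P *v ?g))\<^sup>2)"
    using upper[of "w (Suc k) \<omega>" "w k \<omega>"] by (simp add: gr_def power_mult_distrib inner_commute)
  also have "L / 2 * (\<alpha>\<^sup>2 * (norm (?P *v ?g))\<^sup>2) \<le> L / 2 * (\<alpha>\<^sup>2 * ((?g \<bullet> (?P *v ?g)) / \<mu>t))"
    using L_pos by (intro mult_left_mono inverse_boundsD(4)[OF B]) auto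
  also have "\<dots> = L * \<alpha>\<^sup>2 / (2 * \<mu>t) * (?g \<bullet> (?P *v ?g))" by simp
  finally show ?case
    using inverse_boundsD(5)[OF B, of ?g] by (simp add: gap_def gPg nPg)
qed

text \<open>Smoothness bounds the squared gradient by \<open>2 * L\<close> times the gap, so
  integrability of the gap is the only moment condition that has to travel from one iteration to the
  next.\<close>

lemma integrable_gr:
  assumes "integrable M (gap k)"
  shows "integrable M (\<lambda>\<omega>. (norm (gr k \<omega>))\<^sup>2)" and "integrable M (gr_sq k)"
proof -
  have "(norm (gr k \<omega>))\<^sup>2 \<le> 2 * L * gap k \<omega>" for \<omega>
    unfolding gr_def gap_def by (rule grad_norm_le_gap[OF L_pos upper minimal])
  then show int: "integrable M (\<lambda>\<omega>. (norm (gr k \<omega>))\<^sup>2)"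
    by (intro Bochner_Integration.integrable_bound[OF integrable_mult_right[OF assms, of "2 * L"]])
      (auto intro!: AE_I2 intro: order_trans[OF _ abs_ge_self])
  have "AE \<omega> in M. norm (gr_sq k \<omega>) \<le> norm ((norm (gr k \<omega>))\<^sup>2 / \<mu>t)"
    using P_bounds
  proof eventually_elim
    case (elim \<omega>)
    then show ?case
      using inverse_boundsD(3,5)[of "P k \<omega>" "gr k \<omega>"] \<mu>t by (simp add: gr_sq_def)
  qed
  then show "integrable M (gr_sq k)"
    by (intro Bochner_Integration.integrable_bound[OF integrable_divide[OF int, of \<mu>t]]) auto
qed

lemma gap_le_gr_sq:
  assumes "integrable M (gap k)"
  shows "2 * \<mu> / Lt * expectation (gap k) \<le> expectation (gr_sq k)"
proof -
  have "AE \<omega> in M. 2 * \<mu> / Lt * gap k \<omega> \<le> gr_sq k \<omega>"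
    using P_bounds
  proof eventually_elim
    case (elim \<omega>)
    have "2 * \<mu> * gap k \<omega> / Lt \<le> (norm (gr k \<omega>))\<^sup>2 / Lt"
      using dominated Lt_pos by (intro divide_right_mono) (auto simp: gap_def gr_def)
    also have "\<dots> \<le> gr_sq k \<omega>" using inverse_boundsD(2) elim by (auto simp: gr_sq_def)
    finally show ?case by simp
  qed
  then have "expectation (\<lambda>\<omega>. 2 * \<mu> / Lt * gap k \<omega>) \<le> expectation (gr_sq k)"
    using assms integrable_gr(2)[OF assms] by (intro integral_mono_AE integrable_mult_right) auto
  then show ?thesis by simp
qed

lemma gap_Suc_le:
  assumes le: "AE \<omega> in M. gap (Suc k) \<omega> \<le> X \<omega>" and X: "integrable M X"
  shows "integrable M (gap (Suc k))" and "expectation (gap (Suc k)) \<le> expectation X"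
proof -
  have "AE \<omega> in M. norm (gap (Suc k) \<omega>) \<le> norm (X \<omega>)"
    using le by eventually_elim (simp add: gap_nonneg order_trans[OF _ abs_ge_self])
  then show int: "integrable M (gap (Suc k))"
    by (intro Bochner_Integration.integrable_bound[OF X]) auto
  show "expectation (gap (Suc k)) \<le> expectation X"
    by (intro integral_mono_AE int X le)
qed

lemma one_step_biased:
  assumes gap: "integrable M (gap k)" and step: "L * \<alpha> \<le> \<mu>t"
    and err: "integrable M (err_sq k)" and bound: "expectation (err_sq k) \<le> t * expectation (gr_sq k) + i"
    and t: "t \<le> 1"
  shows "integrable M (gap (Suc k))"
    and "expectation (gap (Suc k)) \<le> (1 - 2 * (\<alpha> * \<mu> * (1 - t) / (2 * Lt))) * expectation (gap k) + \<alpha> / 2 * i"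
proof -
  note gr = integrable_gr(2)[OF gap]
  define X where "X \<omega> = gap k \<omega> - \<alpha> / 2 * gr_sq k \<omega> + \<alpha> / 2 * err_sq k \<omega>" for \<omega>
  have X: "integrable M X"
    unfolding X_def[abs_def] using gap gr err by simp
  have "L * \<alpha> * \<alpha> \<le> \<mu>t * \<alpha>" using step \<alpha> by (intro mult_right_mono) auto
  \<comment> \<open>The coefficient is raised to \<open>\<alpha> / 2\<close>, the value at which
    \<open>2 * cross\<close> cancels the term \<open>- \<alpha> * cross\<close> without any
    knowledge of its sign.\<close>
  then have c: "L * \<alpha>\<^sup>2 / (2 * \<mu>t) \<le> \<alpha> / 2"
    using \<mu>t by (simp add: field_simps power2_eq_square)
  have le: "AE \<omega> in M. gap (Suc k) \<omega> \<le> X \<omega>"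
    using descent[of k]
  proof eventually_elim
    case (elim \<omega>)
    define r where "r = gr_sq k \<omega> + 2 * cross k \<omega> + err_sq k \<omega>"
    have "L * \<alpha>\<^sup>2 / (2 * \<mu>t) * r \<le> \<alpha> / 2 * r"
      using elim c by (intro mult_right_mono) (auto simp: r_def)
    moreover have "\<alpha> / 2 * r - \<alpha> * (gr_sq k \<omega> + cross k \<omega>) = \<alpha> / 2 * err_sq k \<omega> - \<alpha> / 2 * gr_sq k \<omega>"
      by (simp add: r_def field_simps)
    ultimately show ?case using elim unfolding X_def r_def[symmetric] by linarith
  qed
  show "integrable M (gap (Suc k))" by (rule gap_Suc_le(1)[OF le X])
  have "expectation (gap (Suc k)) \<le> expectation X" by (rule gap_Suc_le(2)[OF le X])
  also have "\<dots> = expectation (gap k) - \<alpha> / 2 * expectation (gr_sq k) + \<alpha> / 2 * expectation (err_sq k)"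
    unfolding X_def[abs_def] using gap gr err by simp
  also have "\<dots> \<le> expectation (gap k) - \<alpha> / 2 * expectation (gr_sq k) + \<alpha> / 2 * (t * expectation (gr_sq k) + i)"
    using bound \<alpha> by (intro add_left_mono mult_left_mono) auto
  also have "\<dots> = expectation (gap k) - \<alpha> / 2 * (1 - t) * expectation (gr_sq k) + \<alpha> / 2 * i"
    by (simp add: field_simps)
  also have "\<dots> \<le> expectation (gap k) - \<alpha> / 2 * (1 - t) * (2 * \<mu> / Lt * expectation (gap k)) + \<alpha> / 2 * i"
    using gap_le_gr_sq[OF gap] \<alpha> t by (intro add_right_mono diff_left_mono mult_left_mono) auto
  also have "\<dots> = (1 - 2 * (\<alpha> * \<mu> * (1 - t) / (2 * Lt))) * expectation (gap k) + \<alpha> / 2 * i"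
    using Lt_pos by (simp add: field_simps)
  finally show "expectation (gap (Suc k)) \<le> (1 - 2 * (\<alpha> * \<mu> * (1 - t) / (2 * Lt))) * expectation (gap k) + \<alpha> / 2 * i" .
qed

lemma one_step_unbiased:
  assumes gap: "integrable M (gap k)" and t: "0 \<le> t" and step: "L * \<alpha> * (1 + t) \<le> \<mu>t"
    and err: "integrable M (err_sq k)" and bound: "expectation (err_sq k) \<le> t * expectation (gr_sq k) + i"
    and cross: "integrable M (cross k)" "expectation (cross k) = 0"
  shows "integrable M (gap (Suc k))"
    and "expectation (gap (Suc k)) \<le> (1 - 2 * (\<alpha> * \<mu> / (2 * Lt))) * expectation (gap k) + L * \<alpha>\<^sup>2 / (2 * \<mu>t) * i"
proof -
  note gr = integrable_gr(2)[OF gap]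
  define c where "c = L * \<alpha>\<^sup>2 / (2 * \<mu>t)"
  have c0: "0 \<le> c" using L_pos \<mu>t by (simp add: c_def)
  define X where "X \<omega> = gap k \<omega> - \<alpha> * (gr_sq k \<omega> + cross k \<omega>) + c * (gr_sq k \<omega> + 2 * cross k \<omega> + err_sq k \<omega>)" for \<omega>
  have X: "integrable M X"
    unfolding X_def[abs_def] using gap gr err cross by simp
  have le: "AE \<omega> in M. gap (Suc k) \<omega> \<le> X \<omega>"
    using descent[of k] unfolding X_def c_def by eventually_elim blast
  have "AE \<omega> in M. 0 \<le> gr_sq k \<omega>"
    using P_bounds by eventually_elim (simp add: gr_sq_def inverse_boundsD(5))
  then have gr0: "0 \<le> expectation (gr_sq k)" by (rule integral_nonneg_AE)
  have "L * \<alpha> * (1 + t) * \<alpha> \<le> \<mu>t * \<alpha>" using step \<alpha> by (intro mult_right_mono) auto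
  \<comment> \<open>The step size is chosen for this: the quadratic term consumes at most half of
    the decrease \<open>\<alpha> * gr_sq\<close>, including the share \<open>t\<close> that the
    variance adds.\<close>
  then have ct: "c * (1 + t) \<le> \<alpha> / 2"
    using \<mu>t by (simp add: c_def field_simps power2_eq_square)
  show "integrable M (gap (Suc k))" by (rule gap_Suc_le(1)[OF le X])
  have "expectation (gap (Suc k)) \<le> expectation X" by (rule gap_Suc_le(2)[OF le X])
  also have "\<dots> = expectation (gap k) - \<alpha> * expectation (gr_sq k) + c * (expectation (gr_sq k) + expectation (err_sq k))"
    unfolding X_def[abs_def] using gap gr err cross by simp
  also have "\<dots> \<le> expectation (gap k) - \<alpha> * expectation (gr_sq k) + c * (expectation (gr_sq k) + (t * expectation (gr_sq k) + i))"
    using bound c0 by (intro add_left_mono mult_left_mono) auto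
  also have "\<dots> = expectation (gap k) - \<alpha> * expectation (gr_sq k) + c * (1 + t) * expectation (gr_sq k) + c * i"
    by (simp add: algebra_simps)
  also have "\<dots> \<le> expectation (gap k) - \<alpha> * expectation (gr_sq k) + \<alpha> / 2 * expectation (gr_sq k) + c * i"
    using ct gr0 by (intro add_left_mono add_right_mono mult_right_mono)
  also have "\<dots> = expectation (gap k) - \<alpha> / 2 * expectation (gr_sq k) + c * i"
    by simp
  also have "\<dots> \<le> expectation (gap k) - \<alpha> / 2 * (2 * \<mu> / Lt * expectation (gap k)) + c * i"
    using gap_le_gr_sq[OF gap] \<alpha> by (intro add_right_mono diff_left_mono mult_left_mono) auto
  also have "\<dots> = (1 - 2 * (\<alpha> * \<mu> / (2 * Lt))) * expectation (gap k) + c * i"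
    using Lt_pos by (simp add: field_simps)
  finally show "expectation (gap (Suc k)) \<le> (1 - 2 * (\<alpha> * \<mu> / (2 * Lt))) * expectation (gap k) + L * \<alpha>\<^sup>2 / (2 * \<mu>t) * i"
    by (simp add: c_def)
qed

lemma integrable_err_norm:
  assumes "integrable M (err_sq k)"
  shows "integrable M (\<lambda>\<omega>. (norm (err k \<omega>))\<^sup>2)"
proof (rule Bochner_Integration.integrable_bound[OF integrable_mult_right[OF assms, of Lt]])
  show "AE \<omega> in M. norm ((norm (err k \<omega>))\<^sup>2) \<le> norm (Lt * err_sq k \<omega>)"
    using P_bounds
  proof eventually_elim
    case (elim \<omega>)
    then have "(norm (err k \<omega>))\<^sup>2 \<le> Lt * err_sq k \<omega>"
      unfolding err_sq_def using inverse_boundsD(6) by blast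
    then show ?case by (simp add: order_trans[OF _ abs_ge_self])
  qed
qed simp

text \<open>By symmetry of \<open>P\<close>, the cross term pairs the error with
  \<open>P k \<omega> *v gr k \<omega>\<close>, which is measurable for \<open>N\<close>;
  unbiasedness makes the error orthogonal to it. The squares required for the pairing are controlled
  by the gap and by the error.\<close>

lemma cross_expectation_zero:
  assumes gap: "integrable M (gap k)" and err: "integrable M (\<lambda>\<omega>. (norm (err k \<omega>))\<^sup>2)"
    and N: "sigma_finite_subalgebra M N" and unb: "cond_unbiased M N (g k) (gr k)"
    and meas: "P k \<in> borel_measurable N" "w k \<in> borel_measurable N"
  shows "integrable M (cross k)" and "expectation (cross k) = 0"
proof -
  define Z where "Z \<omega> = P k \<omega> *v gr k \<omega>" for \<omega>
  have "gr k \<in> borel_measurable N"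
    unfolding gr_def[abs_def] using meas(2) borel_measurable_grad[OF f] by measurable
  then have ZN: "Z \<in> borel_measurable N"
    unfolding Z_def[abs_def] using meas(1) by measurable
  have ZM [measurable]: "Z \<in> borel_measurable M" unfolding Z_def[abs_def] by measurable
  have "AE \<omega> in M. norm ((norm (Z \<omega>))\<^sup>2) \<le> norm (gr_sq k \<omega> / \<mu>t)"
    using P_bounds
  proof eventually_elim
    case (elim \<omega>)
    then have "(norm (Z \<omega>))\<^sup>2 \<le> gr_sq k \<omega> / \<mu>t"
      unfolding Z_def gr_sq_def using inverse_boundsD(4) by blast
    then show ?case unfolding real_norm_def by (simp add: order_trans[OF _ abs_ge_self] del: abs_divide)
  qed
  then have Z2: "integrable M (\<lambda>\<omega>. (norm (Z \<omega>))\<^sup>2)"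
    by (intro Bochner_Integration.integrable_bound[OF integrable_divide[OF integrable_gr(2)[OF gap], of \<mu>t]]) auto
  note n2 = integrable_gr(1)[OF gap]
  have "(norm (g k \<omega>))\<^sup>2 \<le> 2 * (norm (gr k \<omega>))\<^sup>2 + 2 * (norm (err k \<omega>))\<^sup>2" for \<omega>
  proof -
    have "norm (g k \<omega>) \<le> norm (gr k \<omega>) + norm (err k \<omega>)"
      using norm_triangle_ineq[of "gr k \<omega>" "err k \<omega>"] by (simp add: err_def)
    then have "(norm (g k \<omega>))\<^sup>2 \<le> (norm (gr k \<omega>) + norm (err k \<omega>))\<^sup>2" by (intro power_mono) auto
    also have "\<dots> \<le> 2 * (norm (gr k \<omega>))\<^sup>2 + 2 * (norm (err k \<omega>))\<^sup>2"
      using sum_squares_bound[of "norm (gr k \<omega>)" "norm (err k \<omega>)"] by (simp add: power2_sum)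
    finally show ?thesis .
  qed
  then have g2: "integrable M (\<lambda>\<omega>. (norm (g k \<omega>))\<^sup>2)"
    by (intro Bochner_Integration.integrable_bound[OF Bochner_Integration.integrable_add[OF integrable_mult_right[OF n2, of 2] integrable_mult_right[OF err, of 2]]])
      (auto intro!: AE_I2 intro: order_trans[OF _ abs_ge_self])
  have Zg: "integrable M (\<lambda>\<omega>. Z \<omega> \<bullet> g k \<omega>)" and Zn: "integrable M (\<lambda>\<omega>. Z \<omega> \<bullet> gr k \<omega>)"
    using Z2 g2 n2 by (auto intro: integrable_inner_L2)
  have "expectation (\<lambda>\<omega>. Z \<omega> \<bullet> g k \<omega>) = expectation (\<lambda>\<omega>. Z \<omega> \<bullet> gr k \<omega>)"
    by (rule cond_unbiased_integral_inner[OF N unb g_meas gr_meas ZN g2 Z2])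
  then have zero: "expectation (\<lambda>\<omega>. Z \<omega> \<bullet> g k \<omega> - Z \<omega> \<bullet> gr k \<omega>) = 0" using Zg Zn by simp
  have eq: "AE \<omega> in M. Z \<omega> \<bullet> g k \<omega> - Z \<omega> \<bullet> gr k \<omega> = cross k \<omega>"
    using P_bounds
  proof eventually_elim
    case (elim \<omega>)
    then have "cross k \<omega> = Z \<omega> \<bullet> err k \<omega>"
      unfolding cross_def Z_def using inverse_boundsD(1) by blast
    then show ?case by (simp add: err_def inner_diff_right)
  qed
  have m: "(\<lambda>\<omega>. Z \<omega> \<bullet> g k \<omega> - Z \<omega> \<bullet> gr k \<omega>) \<in> borel_measurable M" by measurable
  show "integrable M (cross k)"
    using integrable_cong_AE[OF m sq_meas(3) eq] Zg Zn by simp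
  show "expectation (cross k) = 0"
    using integral_cong_AE[OF m sq_meas(3) eq] zero by simp
qed

text \<open>With \<open>m\<close> the maximum of \<open>1 - r\<close> and \<rho>, and
  \<open>C'\<close> the maximum of the initial gap and \<open>C\<close>, the noise is at most
  \<open>r * C' * m ^ k\<close>, and \<open>(1 - 2 * r) + r = 1 - r\<close> is at most
  \<open>m\<close>. The condition \<open>2 * r \<le> 1\<close> keeps the factor of the induction
  hypothesis nonnegative.\<close>

lemma gap_rate:
  assumes step: "\<And>k. integrable M (gap k) \<Longrightarrow> integrable M (gap (Suc k)) \<and>
      expectation (gap (Suc k)) \<le> (1 - 2 * r) * expectation (gap k) + b * \<rho> ^ k"
    and r: "0 \<le> r" "2 * r \<le> 1" and \<rho>: "0 \<le> \<rho>" and b: "0 \<le> b" "b \<le> r * C"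
  shows "integrable M (gap k) \<and> expectation (gap k) \<le> max (f w0 - f xmin) C * max (1 - r) \<rho> ^ k"
proof (induction k)
  case 0
  have "AE \<omega> in M. gap 0 \<omega> = f w0 - f xmin" using AE_space by eventually_elim (simp add: gap_def w_0)
  then have "integrable M (gap 0)" "expectation (gap 0) = f w0 - f xmin"
    using integrable_cong_AE[of "gap 0" M "\<lambda>_. f w0 - f xmin"] integral_cong_AE[of "gap 0" M "\<lambda>_. f w0 - f xmin"]
    by (simp_all add: prob_space)
  then show ?case by simp
next
  case (Suc k)
  define C' where "C' = max (f w0 - f xmin) C"
  define m where "m = max (1 - r) \<rho>"
  have m: "0 \<le> m" "1 - r \<le> m" "\<rho> \<le> m" using \<rho> by (auto simp: m_def)
  have C': "0 \<le> C'" using minimal[of w0] by (simp add: C'_def max_def)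
  have "r * C \<le> r * C'" using r(1) by (intro mult_left_mono) (auto simp: C'_def)
  with b(2) have "b \<le> r * C'" by linarith
  then have "b * \<rho> ^ k \<le> r * C' * m ^ k"
    using b(1) \<rho> m r C' by (intro mult_mono power_mono) auto
  moreover have "(1 - 2 * r) * expectation (gap k) \<le> (1 - 2 * r) * (C' * m ^ k)"
    using Suc r by (intro mult_left_mono) (auto simp: C'_def m_def)
  moreover have "expectation (gap (Suc k)) \<le> (1 - 2 * r) * expectation (gap k) + b * \<rho> ^ k"
    using step Suc by blast
  ultimately have "expectation (gap (Suc k)) \<le> (1 - 2 * r) * (C' * m ^ k) + r * C' * m ^ k" by linarith
  also have "\<dots> = (1 - r) * (C' * m ^ k)" by (simp add: algebra_simps)
  also have "\<dots> \<le> m * (C' * m ^ k)" using m C' by (intro mult_right_mono) auto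
  also have "\<dots> = C' * m ^ Suc k" by simp
  finally show ?case using step Suc by (auto simp: C'_def m_def)
qed

section \<open>Integrated forms of the stochastic norm condition\<close>

lemma cond_norm_expectation:
  assumes N: "sigma_finite_subalgebra M N" and A: "A \<in> borel_measurable M"
    and int: "integrable M (\<lambda>\<omega>. (mat_norm (A \<omega>) (gr k \<omega>))\<^sup>2)" and i: "0 \<le> i"
    and cond: "AE \<omega> in M. nn_cond_exp M N (\<lambda>\<omega>. ennreal ((mat_norm (A \<omega>) (err k \<omega>))\<^sup>2)) \<omega>
      \<le> ennreal (t\<^sup>2 * (mat_norm (A \<omega>) (gr k \<omega>))\<^sup>2 + i)"
  shows "integrable M (\<lambda>\<omega>. (mat_norm (A \<omega>) (err k \<omega>))\<^sup>2)"
    and "expectation (\<lambda>\<omega>. (mat_norm (A \<omega>) (err k \<omega>))\<^sup>2)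
      \<le> t\<^sup>2 * expectation (\<lambda>\<omega>. (mat_norm (A \<omega>) (gr k \<omega>))\<^sup>2) + i"
proof -
  note [measurable] = A
  have X: "(\<lambda>\<omega>. (mat_norm (A \<omega>) (err k \<omega>))\<^sup>2) \<in> borel_measurable M"
    unfolding mat_norm_def by measurable
  have Y: "integrable M (\<lambda>\<omega>. t\<^sup>2 * (mat_norm (A \<omega>) (gr k \<omega>))\<^sup>2 + i)" using int by simp
  have Y0: "AE \<omega> in M. 0 \<le> t\<^sup>2 * (mat_norm (A \<omega>) (gr k \<omega>))\<^sup>2 + i" using i by simp
  note R = nn_cond_exp_le_imp_integral_le[OF N X _ Y Y0 cond]
  show "integrable M (\<lambda>\<omega>. (mat_norm (A \<omega>) (err k \<omega>))\<^sup>2)" using R(1) by simp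
  show "expectation (\<lambda>\<omega>. (mat_norm (A \<omega>) (err k \<omega>))\<^sup>2)
      \<le> t\<^sup>2 * expectation (\<lambda>\<omega>. (mat_norm (A \<omega>) (gr k \<omega>))\<^sup>2) + i"
    using R(2) int by (simp add: prob_space)
qed

text \<open>The square of \<open>mat_norm\<close> equals the quadratic form where the latter is
  nonnegative, which is known almost surely; hence the transfer by almost sure equality.\<close>

lemma cond_norm_inverse:
  assumes gap: "integrable M (gap k)" and N: "sigma_finite_subalgebra M N" and i: "0 \<le> i"
    and A: "\<And>\<omega>. \<omega> \<in> space M \<Longrightarrow> A \<omega> = P k \<omega>"
    and cond: "AE \<omega> in M. nn_cond_exp M N (\<lambda>\<omega>. ennreal ((mat_norm (A \<omega>) (err k \<omega>))\<^sup>2)) \<omega>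
      \<le> ennreal (t\<^sup>2 * (mat_norm (A \<omega>) (gr k \<omega>))\<^sup>2 + i)"
  shows "integrable M (err_sq k)" and "expectation (err_sq k) \<le> t\<^sup>2 * expectation (gr_sq k) + i"
proof -
  have A_meas [measurable]: "A \<in> borel_measurable M"
    using measurable_cong[of M A "P k" borel] A P_meas by blast
  have eq: "AE \<omega> in M. (mat_norm (A \<omega>) (v \<omega>))\<^sup>2 = v \<omega> \<bullet> (P k \<omega> *v v \<omega>)" for v
    using P_bounds AE_space
    by eventually_elim (simp add: A mat_norm_def inverse_boundsD(5))
  have eqs: "AE \<omega> in M. (mat_norm (A \<omega>) (gr k \<omega>))\<^sup>2 = gr_sq k \<omega>"
    "AE \<omega> in M. (mat_norm (A \<omega>) (err k \<omega>))\<^sup>2 = err_sq k \<omega>"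
    unfolding gr_sq_def err_sq_def by (rule eq)+
  have m: "(\<lambda>\<omega>. (mat_norm (A \<omega>) (gr k \<omega>))\<^sup>2) \<in> borel_measurable M"
    "(\<lambda>\<omega>. (mat_norm (A \<omega>) (err k \<omega>))\<^sup>2) \<in> borel_measurable M"
    unfolding mat_norm_def by measurable
  note int = integrable_cong_AE[OF m(1) sq_meas(1) eqs(1)] integrable_cong_AE[OF m(2) sq_meas(2) eqs(2)]
  note expect = integral_cong_AE[OF m(1) sq_meas(1) eqs(1)] integral_cong_AE[OF m(2) sq_meas(2) eqs(2)]
  have "integrable M (\<lambda>\<omega>. (mat_norm (A \<omega>) (gr k \<omega>))\<^sup>2)" using int(1) integrable_gr(2)[OF gap] by simp
  note R = cond_norm_expectation[OF N A_meas this i cond]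
  show "integrable M (err_sq k)" using R(1) int(2) by simp
  show "expectation (err_sq k) \<le> t\<^sup>2 * expectation (gr_sq k) + i" using R(2) expect by simp
qed

text \<open>Passing from the Euclidean norm to that of \<open>P\<close> costs
  \<open>1 / \<mu>t\<close> for the error and a factor \<open>Lt\<close> for the gradient. This is
  the origin of \<open>\<theta>g\<^sup>2 * Lt / \<mu>t\<close> in the second step size
  bound.\<close>

lemma cond_norm_identity:
  assumes gap: "integrable M (gap k)" and N: "sigma_finite_subalgebra M N" and i: "0 \<le> i"
    and A: "\<And>\<omega>. \<omega> \<in> space M \<Longrightarrow> A \<omega> = mat 1"
    and cond: "AE \<omega> in M. nn_cond_exp M N (\<lambda>\<omega>. ennreal ((mat_norm (A \<omega>) (err k \<omega>))\<^sup>2)) \<omega>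
      \<le> ennreal (t\<^sup>2 * (mat_norm (A \<omega>) (gr k \<omega>))\<^sup>2 + i)"
  shows "integrable M (err_sq k)"
    and "expectation (err_sq k) \<le> t\<^sup>2 * Lt / \<mu>t * expectation (gr_sq k) + i / \<mu>t"
proof -
  have A_meas [measurable]: "A \<in> borel_measurable M"
    using measurable_cong[of M A "\<lambda>_. mat 1" borel] A by simp
  have eq: "(mat_norm (A \<omega>) v)\<^sup>2 = (norm v)\<^sup>2" if "\<omega> \<in> space M" for \<omega> v
    using that by (simp add: A mat_norm_def dot_square_norm)
  have int: "integrable M (\<lambda>\<omega>. (mat_norm (A \<omega>) (v \<omega>))\<^sup>2) \<longleftrightarrow> integrable M (\<lambda>\<omega>. (norm (v \<omega>))\<^sup>2)" for v
    by (rule Bochner_Integration.integrable_cong) (auto simp: eq)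
  have expect: "expectation (\<lambda>\<omega>. (mat_norm (A \<omega>) (v \<omega>))\<^sup>2) = expectation (\<lambda>\<omega>. (norm (v \<omega>))\<^sup>2)" for v
    by (rule Bochner_Integration.integral_cong) (auto simp: eq)
  note n2 = integrable_gr[OF gap]
  have "integrable M (\<lambda>\<omega>. (mat_norm (A \<omega>) (gr k \<omega>))\<^sup>2)" using n2(1) int by simp
  note R = cond_norm_expectation[OF N A_meas this i cond, unfolded int expect]
  have le: "AE \<omega> in M. err_sq k \<omega> \<le> (norm (err k \<omega>))\<^sup>2 / \<mu>t"
    using P_bounds unfolding err_sq_def by eventually_elim (simp add: inverse_boundsD(3))
  moreover have "AE \<omega> in M. 0 \<le> err_sq k \<omega>"
    using P_bounds unfolding err_sq_def by eventually_elim (simp add: inverse_boundsD(5))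
  ultimately have "AE \<omega> in M. norm (err_sq k \<omega>) \<le> norm ((norm (err k \<omega>))\<^sup>2 / \<mu>t)"
    by eventually_elim (use \<mu>t in simp)
  then show int_err: "integrable M (err_sq k)"
    by (intro Bochner_Integration.integrable_bound[OF integrable_divide[OF R(1), of \<mu>t]]) auto
  have "AE \<omega> in M. (norm (gr k \<omega>))\<^sup>2 \<le> Lt * gr_sq k \<omega>"
    using P_bounds unfolding gr_sq_def by eventually_elim (simp add: inverse_boundsD(6))
  then have "expectation (\<lambda>\<omega>. (norm (gr k \<omega>))\<^sup>2) \<le> expectation (\<lambda>\<omega>. Lt * gr_sq k \<omega>)"
    using n2 by (intro integral_mono_AE) auto
  then have n: "expectation (\<lambda>\<omega>. (norm (gr k \<omega>))\<^sup>2) \<le> Lt * expectation (gr_sq k)" by simp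
  have "expectation (err_sq k) \<le> expectation (\<lambda>\<omega>. (norm (err k \<omega>))\<^sup>2 / \<mu>t)"
    using R(1) by (intro integral_mono_AE int_err le) simp
  also have "\<dots> = expectation (\<lambda>\<omega>. (norm (err k \<omega>))\<^sup>2) / \<mu>t" by simp
  also have "\<dots> \<le> (t\<^sup>2 * (Lt * expectation (gr_sq k)) + i) / \<mu>t"
    using R(2) mult_left_mono[OF n, of "t\<^sup>2"] \<mu>t by (intro divide_right_mono) auto
  also have "\<dots> = t\<^sup>2 * Lt / \<mu>t * expectation (gr_sq k) + i / \<mu>t" by (simp add: add_divide_distrib)
  finally show "expectation (err_sq k) \<le> t\<^sup>2 * Lt / \<mu>t * expectation (gr_sq k) + i / \<mu>t" .
qed

end

section \<open>Convergence rates\<close>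

theorem theorem4p2:
  fixes M :: "'a measure" and D :: "'z measure"
    and F :: "real^'n \<Rightarrow> 'z \<Rightarrow> real" and f :: "real^'n \<Rightarrow> real"
    and \<zeta> :: "nat \<Rightarrow> 'a \<Rightarrow> 'z" and S :: "nat \<Rightarrow> 'a \<Rightarrow> nat set"
    and g w :: "nat \<Rightarrow> 'a \<Rightarrow> real^'n" and w0 wstar :: "real^'n"
    and Ht A :: "nat \<Rightarrow> 'a \<Rightarrow> real^'n^'n"
    and \<gamma> :: "nat \<Rightarrow> nat \<Rightarrow> real" and \<alpha>s \<theta> \<iota> :: "nat \<Rightarrow> real"
    and L Lt \<mu> \<mu>t ag \<alpha> \<theta>g :: real
  assumes M: "prob_space M" and D: "prob_space D"
    \<comment> \<open>samples, the functions \<open>F\<close> and \<open>f\<close>\<close>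
    and \<zeta>_indep: "prob_space.indep_vars M (\<lambda>_. D) \<zeta> UNIV"
    and \<zeta>_law: "\<And>i. distr M D (\<zeta> i) = D"
    and F_smooth: "\<And>z. z \<in> space D \<Longrightarrow> twice_cont_diff (\<lambda>x. F x z)"
    and F_int: "\<And>x. integrable D (F x)"
    and f_def: "\<And>x. f x = (\<integral>z. F x z \<partial>D)"
    and f_twice: "twice_diff f"
    and upper: "spectral_upper_bound M F \<zeta> L"
    and \<mu>_pos: "\<mu> > 0"
    and lower: "\<And>x. \<mu> *\<^sub>R mat 1 \<preceq>\<^sub>L hess f x"
    and wstar: "is_arg_min f (\<lambda>_. True) wstar"
    \<comment> \<open>Hessian samples and Hessian approximation\<close>
    and S_meas: "\<And>k. S k \<in> measurable M (count_space UNIV)"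
    and S_fin: "\<And>k \<omega>. \<omega> \<in> space M \<Longrightarrow> finite (S k \<omega>) \<and> S k \<omega> \<noteq> {}"
    and \<gamma>_range: "\<And>k i. i \<le> k \<Longrightarrow> \<gamma> k i \<in> {0..1}"
    and \<gamma>_sum: "\<And>k. (\<Sum>i\<le>k. \<gamma> k i) = 1"
    and \<mu>t_pos: "\<mu>t > 0"
    and Ht: "\<And>k \<omega>. \<omega> \<in> space M \<Longrightarrow> Ht k \<omega> = modified_hess \<mu>t (hess_avg F \<zeta> S \<gamma> w k \<omega>)"
    and Ht_meas: "\<And>k. Ht k \<in> borel_measurable M"
    and Ht_upper: "AE \<omega> in M. \<forall>k. Ht k \<omega> \<preceq>\<^sub>L Lt *\<^sub>R mat 1"
    and Lt_le: "Lt \<le> L + \<mu>t"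
    \<comment> \<open>the iteration\<close>
    and g_meas: "\<And>k. g k \<in> borel_measurable M"
    and g_S_indep: "\<And>k. cond_indep_sets M (past M D \<zeta> S g w k)
          (var_events M (g k)) (sigma_sets (space M) (sample_events M D \<zeta> S k))"
    and w_0: "\<And>\<omega>. \<omega> \<in> space M \<Longrightarrow> w 0 \<omega> = w0"
    and w_Suc: "\<And>k \<omega>. \<omega> \<in> space M \<Longrightarrow>
          w (Suc k) \<omega> = w k \<omega> - \<alpha>s k *\<^sub>R (matrix_inv (Ht k \<omega>) *v g k \<omega>)"
    \<comment> \<open>stochastic norm condition\<close>
    and norm_cond: "\<And>k. AE \<omega> in M.
          nn_cond_exp M (history M D \<zeta> S g w k (A k))
            (\<lambda>\<omega>. ennreal ((mat_norm (A k \<omega>) (g k \<omega> - grad f (w k \<omega>)))\<^sup>2)) \<omega>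
          \<le> ennreal ((\<theta> k)\<^sup>2 * (mat_norm (A k \<omega>) (grad f (w k \<omega>)))\<^sup>2 + \<iota> k)"
    and \<iota>_0: "\<iota> 0 > 0" and \<iota>_Suc: "\<And>k. \<iota> (Suc k) = \<iota> k * ag"
    and ag: "0 \<le> ag" "ag < 1"
  shows
    "((\<forall>k. \<forall>\<omega>\<in>space M. A k \<omega> = matrix_inv (Ht k \<omega>)) \<and>
      (\<forall>k. \<theta> k = \<theta>g) \<and> 0 \<le> \<theta>g \<and> \<theta>g < 1 \<and>
      (\<forall>k. \<alpha>s k = \<alpha>) \<and> 0 < \<alpha> \<and> \<alpha> \<le> \<mu>t / L
      \<longrightarrow> (\<forall>k. integrable M (\<lambda>\<omega>. f (w k \<omega>) - f wstar) \<and>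
            (\<integral>\<omega>. f (w k \<omega>) - f wstar \<partial>M)
            \<le> max (f w0 - f wstar) (Lt * \<iota> 0 / (\<mu> * (1 - \<theta>g\<^sup>2)))
              * (max (1 - \<alpha> * \<mu> * (1 - \<theta>g\<^sup>2) / (2 * Lt)) ag) ^ k))
     \<and>
     ((\<forall>k. cond_unbiased M (history M D \<zeta> S g w k (Ht k)) (g k) (\<lambda>\<omega>. grad f (w k \<omega>))) \<and>
      (\<forall>k. \<theta> k = \<theta>g) \<and> 0 \<le> \<theta>g \<and>
      (\<forall>k. \<alpha>s k = \<alpha>) \<and> 0 < \<alpha> \<and>
      ((\<forall>k. \<forall>\<omega>\<in>space M. A k \<omega> = matrix_inv (Ht k \<omega>)) \<and> \<alpha> \<le> \<mu>t / (L * (1 + \<theta>g\<^sup>2)) \<or>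
       (\<forall>k. \<forall>\<omega>\<in>space M. A k \<omega> = mat 1) \<and> \<alpha> \<le> \<mu>t / (L * (1 + \<theta>g\<^sup>2 * Lt / \<mu>t)))
      \<longrightarrow> (\<forall>k. integrable M (\<lambda>\<omega>. f (w k \<omega>) - f wstar) \<and>
            (\<integral>\<omega>. f (w k \<omega>) - f wstar \<partial>M)
            \<le> max (f w0 - f wstar) (L * Lt * \<alpha> * \<iota> 0 / (\<mu> * \<mu>t * min 1 \<mu>t))
              * (max (1 - \<alpha> * \<mu> / (2 * Lt)) ag) ^ k))"
proof -
  interpret M: prob_space M by fact
  have \<zeta>_meas: "\<zeta> i \<in> measurable M D" for i
    using \<zeta>_indep unfolding M.indep_vars_def by auto
  have F_twice: "twice_diff (\<lambda>x. F x (\<zeta> i \<omega>))" if "\<omega> \<in> space M" for i \<omega>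
    using F_smooth measurable_space[OF \<zeta>_meas that] by (auto simp: twice_cont_diff_def)
  define P where "P k \<omega> = matrix_inv (Ht k \<omega>)" for k \<omega>
  have Ht_sym: "transpose (hess_avg F \<zeta> S \<gamma> w k \<omega>) = hess_avg F \<zeta> S \<gamma> w k \<omega>" if "\<omega> \<in> space M" for k \<omega>
    by (rule transpose_hess_avg) (rule F_twice[OF that])
  have Ht_inv: "invertible (Ht k \<omega>)" if "\<omega> \<in> space M" for k \<omega>
    using that modified_hess_invertible[OF Ht_sym \<mu>t_pos] by (simp add: Ht)
  have P_meas: "P k \<in> borel_measurable M" for k
    unfolding P_def[abs_def] by (rule borel_measurable_matrix_inv[OF Ht_meas Ht_inv])
  have P_bounds: "AE \<omega> in M. (\<forall>k. inverse_bounds \<mu>t Lt (P k \<omega>)) \<and> \<mu>t \<le> Lt"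
    using Ht_upper AE_space
  proof eventually_elim
    case (elim \<omega>)
    have le: "modified_hess \<mu>t (hess_avg F \<zeta> S \<gamma> w k \<omega>) \<preceq>\<^sub>L Lt *\<^sub>R mat 1" for k
      using elim by (simp add: Ht)
    note B = modified_hess_inverse_bounds[OF Ht_sym[OF elim(2)] \<mu>t_pos le]
    have "inverse_bounds \<mu>t Lt (P k \<omega>)" for k
      unfolding inverse_bounds_def P_def Ht[OF elim(2)] using B(2-5) by blast
    then show ?case using B(1) by blast
  qed
  \<comment> \<open>A statement without \<omega> that holds almost surely on a probability space
    simply holds.\<close>
  then have \<mu>t_le: "\<mu>t \<le> Lt" by (auto simp: AE_conj_iff)
  obtain Ls :: "nat \<Rightarrow> real" where Ls: "\<forall>n\<ge>1. 0 < Ls n \<and> Ls n \<le> L \<and>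
      (\<forall>T. finite T \<and> card T = n \<longrightarrow>
         (AE \<omega> in M. \<forall>x. hess (sample_avg F \<zeta> T \<omega>) x \<preceq>\<^sub>L Ls n *\<^sub>R mat 1))"
    using upper unfolding spectral_upper_bound_def by blast
  \<comment> \<open>Samples of size one suffice: the average over the index set \<open>{0}\<close>
    is the function of the sample \<open>\<zeta> 0\<close>, and \<zeta>_law makes \<open>f\<close>
    its expectation.\<close>
  define c where "c = Ls 1"
  have c: "0 < c" "c \<le> L" using Ls by (simp_all add: c_def)
  have "AE \<omega> in M. \<forall>x. hess (sample_avg F \<zeta> {0} \<omega>) x \<preceq>\<^sub>L Ls 1 *\<^sub>R mat 1"
    using Ls[THEN spec, of 1] by auto
  then have ae: "AE \<omega> in M. \<forall>x. hess (\<lambda>x. F x (\<zeta> 0 \<omega>)) x \<preceq>\<^sub>L c *\<^sub>R mat 1"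
    by (simp add: sample_avg_def[abs_def] c_def)
  have F_upper: "AE \<omega> in M. twice_diff (\<lambda>x. F x (\<zeta> 0 \<omega>)) \<and> (\<forall>x. hess (\<lambda>x. F x (\<zeta> 0 \<omega>)) x \<preceq>\<^sub>L L *\<^sub>R mat 1)"
    using ae AE_space
  proof eventually_elim
    case (elim \<omega>)
    have "v \<bullet> (hess (\<lambda>x. F x (\<zeta> 0 \<omega>)) x *v v) \<le> L * (v \<bullet> v)" for x v
    proof -
      have "v \<bullet> (hess (\<lambda>x. F x (\<zeta> 0 \<omega>)) x *v v) \<le> c * (v \<bullet> v)"
        using elim(1) by (simp add: loewner_le_scaleR_mat_1)
      also have "\<dots> \<le> L * (v \<bullet> v)" using c(2) by (intro mult_right_mono) auto
      finally show ?thesis .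
    qed
    then show ?case using F_twice[OF elim(2)] by (simp add: loewner_le_scaleR_mat_1)
  qed
  have F_int': "integrable M (\<lambda>\<omega>. F x (\<zeta> 0 \<omega>))" and f_eq: "f x = (\<integral>\<omega>. F x (\<zeta> 0 \<omega>) \<partial>M)" for x
  proof -
    have m: "F x \<in> borel_measurable D" using F_int by blast
    show "integrable M (\<lambda>\<omega>. F x (\<zeta> 0 \<omega>))"
      using integrable_distr_eq[OF \<zeta>_meas m, of 0] F_int by (simp add: \<zeta>_law)
    show "f x = (\<integral>\<omega>. F x (\<zeta> 0 \<omega>) \<partial>M)"
      using integral_distr[OF \<zeta>_meas m, of 0] by (simp add: \<zeta>_law f_def)
  qed
  have f_upper: "f y \<le> f x + (y - x) \<bullet> grad f x + L / 2 * (norm (y - x))\<^sup>2" for x y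
    using f_twice
    by (intro quadratic_upper_bound_expectation[OF M F_int' F_upper f_eq]) (simp add: twice_diff_def)
  \<comment> \<open>On a unit vector the lower and the upper quadratic bound differ only in their
    constants.\<close>
  have \<mu>_le: "\<mu> \<le> L"
  proof -
    define e :: "real^'n" where "e = axis undefined 1"
    have "norm (e - 0) = 1" by (simp add: e_def norm_eq_1 inner_axis_axis)
    then show ?thesis
      using f_upper[of e 0] quadratic_lower_bound[OF f_twice lower, of 0 e] by simp
  qed
  \<comment> \<open>For \<open>ag = 0\<close> the convention that a zeroth power is 1 retains the
    initial value \<iota> 0.\<close>
  have \<iota>_pow: "\<iota> k = \<iota> 0 * ag ^ k" for k by (induction k) (simp_all add: \<iota>_Suc mult.assoc)
  have \<iota>_nonneg: "0 \<le> \<iota> k" for k using \<iota>_0 ag by (subst \<iota>_pow) simp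
  have process: "quasi_newton M f wstar w0 w g P L Lt \<mu> \<mu>t \<alpha>"
    if "\<forall>k. \<alpha>s k = \<alpha>" "0 < \<alpha>"
  proof unfold_locales
    show "twice_diff f" by fact
    show "f y \<le> f x + (y - x) \<bullet> grad f x + L / 2 * (norm (y - x))\<^sup>2" for x y by (rule f_upper)
    show "2 * \<mu> * (f x - f wstar) \<le> (norm (grad f x))\<^sup>2" for x
      by (rule gradient_dominated[OF f_twice \<mu>_pos lower])
    show "f wstar \<le> f x" for x using wstar by (simp add: is_arg_min_def not_less)
    show "AE \<omega> in M. \<forall>k. inverse_bounds \<mu>t Lt (P k \<omega>)" using P_bounds by eventually_elim blast
    show "w (Suc k) \<omega> = w k \<omega> - \<alpha> *\<^sub>R (P k \<omega> *v g k \<omega>)" if "\<omega> \<in> space M" for k \<omega>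
      using w_Suc[OF that] \<open>\<forall>k. \<alpha>s k = \<alpha>\<close> by (simp add: P_def)
  qed (use \<mu>_pos \<mu>_le \<mu>t_pos \<mu>t_le that P_meas g_meas w_0 in auto)
  have L_pos: "0 < L" using c by simp
  show ?thesis
  proof (intro conjI impI; elim conjE)

    \<comment> \<open>First part: gradients with possible bias\<close>
    assume A: "\<forall>k. \<forall>\<omega>\<in>space M. A k \<omega> = matrix_inv (Ht k \<omega>)" and \<theta>: "\<forall>k. \<theta> k = \<theta>g"
      and \<theta>g: "0 \<le> \<theta>g" "\<theta>g < 1" and \<alpha>s: "\<forall>k. \<alpha>s k = \<alpha>" and \<alpha>_range: "0 < \<alpha>" "\<alpha> \<le> \<mu>t / L"
    interpret quasi_newton M f wstar w0 w g P L Lt \<mu> \<mu>t \<alpha> by (rule process[OF \<alpha>s \<alpha>_range(1)])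
    have A_meas: "A k \<in> borel_measurable M" for k
      using measurable_cong[of M "A k" "P k" borel] A P_meas by (simp add: P_def)
    have N: "sigma_finite_subalgebra M (history M D \<zeta> S g w k (A k))" for k
      by (intro M.sigma_finite_subalgebra_prob history_subalgebra(1) S_meas \<zeta>_meas g_meas w_meas A_meas)
    have cond: "AE \<omega> in M. nn_cond_exp M (history M D \<zeta> S g w k (A k))
        (\<lambda>\<omega>. ennreal ((mat_norm (A k \<omega>) (err k \<omega>))\<^sup>2)) \<omega>
        \<le> ennreal (\<theta>g\<^sup>2 * (mat_norm (A k \<omega>) (gr k \<omega>))\<^sup>2 + \<iota> k)" for k
      using norm_cond[of k] \<theta> by (simp add: err_def gr_def)
    have L\<alpha>: "L * \<alpha> \<le> \<mu>t" using \<alpha>_range L_pos by (simp add: field_simps)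
    have \<theta>2: "\<theta>g\<^sup>2 < 1" using \<theta>g by (simp add: power_less_one_iff abs_square_less_1)
    define r where "r = \<alpha> * \<mu> * (1 - \<theta>g\<^sup>2) / (2 * Lt)"
    define C where "C = Lt * \<iota> 0 / (\<mu> * (1 - \<theta>g\<^sup>2))"
    have "integrable M (gap (Suc k)) \<and>
      M.expectation (gap (Suc k)) \<le> (1 - 2 * r) * M.expectation (gap k) + \<alpha> / 2 * \<iota> 0 * ag ^ k"
      if gap: "integrable M (gap k)" for k
    proof -
      note E = cond_norm_inverse[OF gap N \<iota>_nonneg _ cond]
      have "A k \<omega> = P k \<omega>" if "\<omega> \<in> space M" for \<omega> using A that by (simp add: P_def)
      note E = E[OF this]
      show ?thesis
        using one_step_biased[OF gap L\<alpha> E less_imp_le[OF \<theta>2]]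
        by (simp add: r_def \<iota>_pow[of k] mult.assoc)
    qed
    moreover have "0 \<le> r" using \<alpha> \<mu>_pos \<theta>2 Lt_pos by (simp add: r_def)
    moreover have "2 * r \<le> 1"
    proof -
      have "\<alpha> * \<mu> * (1 - \<theta>g\<^sup>2) \<le> \<alpha> * \<mu> * 1" using \<alpha> \<mu>_pos by (intro mult_left_mono) auto
      also have "\<dots> \<le> L * \<alpha>" using \<mu>_le \<alpha> by simp
      also have "\<dots> \<le> Lt" using L\<alpha> \<mu>t_le by simp
      finally show ?thesis using Lt_pos by (simp add: r_def)
    qed
    moreover have "\<alpha> / 2 * \<iota> 0 \<le> r * C"
    proof -
      \<comment> \<open>The first constant is the noise coefficient divided by \<open>r\<close>, so
        the inequality required by \<open>gap_rate\<close> is an equality.\<close>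
      have "\<alpha> * \<mu> * s / (2 * Lt) * (Lt * \<iota> 0 / (\<mu> * s)) = \<alpha> / 2 * \<iota> 0" if "0 < s" for s
        using that \<mu>_pos Lt_pos by simp
      from this[of "1 - \<theta>g\<^sup>2"] show ?thesis using \<theta>2 by (simp add: r_def C_def)
    qed
    moreover have "0 \<le> \<alpha> / 2 * \<iota> 0" using \<alpha> \<iota>_0 by simp
    ultimately have "integrable M (gap k) \<and> M.expectation (gap k) \<le> max (f w0 - f wstar) C * max (1 - r) ag ^ k" for k
      using ag(1) by (intro gap_rate[where b="\<alpha> / 2 * \<iota> 0"]) auto
    then show "\<forall>k. integrable M (\<lambda>\<omega>. f (w k \<omega>) - f wstar) \<and>
            (\<integral>\<omega>. f (w k \<omega>) - f wstar \<partial>M)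
            \<le> max (f w0 - f wstar) (Lt * \<iota> 0 / (\<mu> * (1 - \<theta>g\<^sup>2)))
              * (max (1 - \<alpha> * \<mu> * (1 - \<theta>g\<^sup>2) / (2 * Lt)) ag) ^ k"
      by (simp add: gap_def[abs_def] r_def C_def)
  next

    \<comment> \<open>Second part: unbiased gradients\<close>
    assume unb: "\<forall>k. cond_unbiased M (history M D \<zeta> S g w k (Ht k)) (g k) (\<lambda>\<omega>. grad f (w k \<omega>))"
      and \<theta>: "\<forall>k. \<theta> k = \<theta>g" and \<theta>g: "0 \<le> \<theta>g" and \<alpha>s: "\<forall>k. \<alpha>s k = \<alpha>" and \<alpha>: "0 < \<alpha>"
      and cases: "(\<forall>k. \<forall>\<omega>\<in>space M. A k \<omega> = matrix_inv (Ht k \<omega>)) \<and> \<alpha> \<le> \<mu>t / (L * (1 + \<theta>g\<^sup>2)) \<or>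
       (\<forall>k. \<forall>\<omega>\<in>space M. A k \<omega> = mat 1) \<and> \<alpha> \<le> \<mu>t / (L * (1 + \<theta>g\<^sup>2 * Lt / \<mu>t))"
    interpret quasi_newton M f wstar w0 w g P L Lt \<mu> \<mu>t \<alpha> by (rule process[OF \<alpha>s \<alpha>])
    have cond: "AE \<omega> in M. nn_cond_exp M (history M D \<zeta> S g w k (A k))
        (\<lambda>\<omega>. ennreal ((mat_norm (A k \<omega>) (err k \<omega>))\<^sup>2)) \<omega>
        \<le> ennreal (\<theta>g\<^sup>2 * (mat_norm (A k \<omega>) (gr k \<omega>))\<^sup>2 + \<iota> k)" for k
      using norm_cond[of k] \<theta> by (simp add: err_def gr_def)
    have N: "sigma_finite_subalgebra M (history M D \<zeta> S g w k X)" if "X \<in> borel_measurable M"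
      for k and X :: "'a \<Rightarrow> real^'n^'n"
      by (intro M.sigma_finite_subalgebra_prob history_subalgebra(1) S_meas \<zeta>_meas g_meas w_meas that)
    \<comment> \<open>Both norms reduce to one estimate: \<open>\<tau> = \<theta>g\<^sup>2\<close>
      and \<open>d = 1\<close> for the inverse Hessian,
      \<open>\<tau> = \<theta>g\<^sup>2 * Lt / \<mu>t\<close> and \<open>d = \<mu>t\<close> for the
      identity. In either case \<open>d\<close> is at least \<open>min 1 \<mu>t\<close>, which
      explains the denominator of the second constant.\<close>
    obtain \<tau> d where \<tau>: "0 \<le> \<tau>" "L * \<alpha> * (1 + \<tau>) \<le> \<mu>t" and d: "0 < d" "min 1 \<mu>t \<le> d"
      and E: "\<And>k. integrable M (gap k) \<Longrightarrow> integrable M (err_sq k) \<and>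
        M.expectation (err_sq k) \<le> \<tau> * M.expectation (gr_sq k) + \<iota> k / d"
      using cases
    proof (elim disjE conjE)
      assume A: "\<forall>k. \<forall>\<omega>\<in>space M. A k \<omega> = matrix_inv (Ht k \<omega>)" and le: "\<alpha> \<le> \<mu>t / (L * (1 + \<theta>g\<^sup>2))"
      have A_meas: "A k \<in> borel_measurable M" for k
        using measurable_cong[of M "A k" "P k" borel] A P_meas by (simp add: P_def)
      have "0 < L * (1 + \<theta>g\<^sup>2)" using L_pos by (intro mult_pos_pos) (auto simp: add_pos_nonneg)
      then have "L * \<alpha> * (1 + \<theta>g\<^sup>2) \<le> \<mu>t" using le by (simp add: pos_le_divide_eq mult.commute mult.left_commute)
      moreover have "integrable M (err_sq k) \<and> M.expectation (err_sq k) \<le> \<theta>g\<^sup>2 * M.expectation (gr_sq k) + \<iota> k / 1"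
        if gap: "integrable M (gap k)" for k
        using cond_norm_inverse[OF gap N[OF A_meas] \<iota>_nonneg _ cond] A by (simp add: P_def)
      ultimately show ?thesis using that[of "\<theta>g\<^sup>2" 1] by simp
    next
      assume A: "\<forall>k. \<forall>\<omega>\<in>space M. A k \<omega> = mat 1" and le: "\<alpha> \<le> \<mu>t / (L * (1 + \<theta>g\<^sup>2 * Lt / \<mu>t))"
      have A_meas: "A k \<in> borel_measurable M" for k
        using measurable_cong[of M "A k" "\<lambda>_. mat 1" borel] A by simp
      have \<tau>0: "0 \<le> \<theta>g\<^sup>2 * Lt / \<mu>t" using Lt_pos \<mu>t_pos by simp
      then have "0 < L * (1 + \<theta>g\<^sup>2 * Lt / \<mu>t)" using L_pos by (intro mult_pos_pos) linarith+
      then have "L * \<alpha> * (1 + \<theta>g\<^sup>2 * Lt / \<mu>t) \<le> \<mu>t"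
        using le by (simp only: pos_le_divide_eq mult.commute mult.left_commute)
      moreover have "integrable M (err_sq k) \<and>
          M.expectation (err_sq k) \<le> \<theta>g\<^sup>2 * Lt / \<mu>t * M.expectation (gr_sq k) + \<iota> k / \<mu>t"
        if gap: "integrable M (gap k)" for k
        using cond_norm_identity[OF gap N[OF A_meas] \<iota>_nonneg _ cond] A by blast
      ultimately show ?thesis using that[of "\<theta>g\<^sup>2 * Lt / \<mu>t" \<mu>t] \<tau>0 \<mu>t_pos by simp
    qed
    define r where "r = \<alpha> * \<mu> / (2 * Lt)"
    define C where "C = L * Lt * \<alpha> * \<iota> 0 / (\<mu> * \<mu>t * min 1 \<mu>t)"
    define b where "b = L * \<alpha>\<^sup>2 / (2 * \<mu>t) * (\<iota> 0 / d)"
    have "integrable M (gap (Suc k)) \<and>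
      M.expectation (gap (Suc k)) \<le> (1 - 2 * r) * M.expectation (gap k) + b * ag ^ k"
      if gap: "integrable M (gap k)" for k
    proof -
      note E = E[OF gap, THEN conjunct1] E[OF gap, THEN conjunct2]
      \<comment> \<open>Unbiasedness is conditional on the history with \<open>Ht k\<close>, the
        norm condition on that with \<open>A k\<close>, which is constant for the identity norm. The
        cross term is handled in the former, where the inverse of \<open>Ht k\<close> is
        measurable.\<close>
      let ?N = "history M D \<zeta> S g w k (Ht k)"
      note H = history_subalgebra[where S=S and \<zeta>=\<zeta> and D=D and g=g and w=w and k=k and X="Ht k",
          OF S_meas \<zeta>_meas g_meas w_meas Ht_meas]
      have "space ?N = space M" using H(1) by (simp add: subalgebra_def)
      then have "P k \<in> borel_measurable ?N"
        unfolding P_def[abs_def] using Ht_inv by (intro borel_measurable_matrix_inv[OF H(3)]) auto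
      note cross = cross_expectation_zero[OF gap integrable_err_norm[OF E(1)] N[OF Ht_meas] _ this H(2)]
      have "cond_unbiased M ?N (g k) (gr k)" using unb by (simp add: gr_def[abs_def])
      note cross = cross[OF this]
      show ?thesis
        using one_step_unbiased[OF gap \<tau> E cross]
        by (simp add: r_def b_def \<iota>_pow[of k])
    qed
    moreover have "0 \<le> r" using \<alpha> \<mu>_pos Lt_pos by (simp add: r_def)
    moreover have "2 * r \<le> 1"
    proof -
      have "\<alpha> * \<mu> \<le> L * \<alpha>" using \<mu>_le \<alpha> by simp
      also have "L * \<alpha> * 1 \<le> L * \<alpha> * (1 + \<tau>)" using L_pos \<alpha> \<tau>(1) by (intro mult_left_mono) auto
      then have "L * \<alpha> \<le> Lt" using \<tau>(2) \<mu>t_le by linarith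
      finally show ?thesis using Lt_pos by (simp add: r_def)
    qed
    moreover have "b \<le> r * C"
    proof -
      have m: "0 < min 1 \<mu>t" using \<mu>t_pos by simp
      have "b \<le> L * \<alpha>\<^sup>2 / (2 * \<mu>t) * (\<iota> 0 / min 1 \<mu>t)"
        unfolding b_def using m d \<iota>_0 L_pos \<mu>t_pos by (intro mult_left_mono divide_left_mono) auto
      also have "\<dots> = r * C"
        using \<mu>_pos Lt_pos by (simp add: r_def C_def power2_eq_square mult_ac)
      finally show ?thesis .
    qed
    moreover have "0 \<le> b" using L_pos \<mu>t_pos \<iota>_0 d by (simp add: b_def)
    ultimately have "integrable M (gap k) \<and> M.expectation (gap k) \<le> max (f w0 - f wstar) C * max (1 - r) ag ^ k" for k
      using ag(1) by (intro gap_rate[where b=b]) auto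
    then show "\<forall>k. integrable M (\<lambda>\<omega>. f (w k \<omega>) - f wstar) \<and>
            (\<integral>\<omega>. f (w k \<omega>) - f wstar \<partial>M)
            \<le> max (f w0 - f wstar) (L * Lt * \<alpha> * \<iota> 0 / (\<mu> * \<mu>t * min 1 \<mu>t))
              * (max (1 - \<alpha> * \<mu> / (2 * Lt)) ag) ^ k"
      by (simp add: gap_def[abs_def] r_def C_def)
  qed
qed

end
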